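(* Let $N\ge 3$, $\mu\neq 0$ and $\nu>0$, and let $T_\nu$ be the CUSUM stopping rule in the continuous-time Brownian sensor model (defined in the context). Let $\mathfrak{s}^*$ be the attack strategy in which sensor $1$ is compromised ($n^c=1$) and reports, irrespective of its own observation $\xi^{(1)}$, the signal $$\bar\xi^{(1)}_t=N\mu t+W^{(1)}_t,\qquad t\ge 0.$$ Under this attack strategy, the average run length (ARL) to false alarm and the detection delay of CUSUM satisfy $$\mathrm{ARL}(T_\nu)\le E_{\infty,1,\mathfrak{s}^*}[T_\nu]=\frac{e^{-\nu}+\nu-1}{N\mu^2/2}$$ and $$d(T_\nu)\ge E_{0,1,\mathfrak{s}^*}[T_\nu]\ge \frac{e^{-\nu}+\nu-1}{(3N/2-1)\mu^2},$$ respectively. As a result, instead of logarithmically, the detection delay of CUSUM scales linearly with the ARL to false alarm under a simple attack.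
   Context: **Model.** There are $N\ge 3$ sensors. Sensor $n\in\{1,\dots,N\}$ observes $\xi^{(n)}_t=\mu(t-\tau)^++W^{(n)}_t$, $t\ge 0$, where $\mu$ is the signal strength at each sensor after the change, $W^{(1)},\dots,W^{(N)}$ are independent standard Brownian motions, and $\tau$ is an unknown constant, the time at which the signals at all sensors change ($\tau=\infty$ means that the change never occurs). One sensor, with unknown index $n^c$, might be compromised. Sensor $n$ reports $\bar\xi^{(n)}_t$ to a fusion center. If sensor $n$ is honest then $\bar\xi^{(n)}_t=\xi^{(n)}_t$; for the compromised sensor, $\bar\xi^{(n^c)}_t$ depends on the attacker's strategy $\mathfrak{s}$, which can use the information $\xi^{(n^c)}_t$ observed by the attacker, and on which no assumption is made. Let $\mathcal{F}_t=\sigma\{(\bar\xi^{(1)}_s,\dots,\bar\xi^{(N)}_s):s\le t\}$. $E_{\tau,n^c,\mathfrak{s}}$ denotes expectation under the measure when the change occurs at time $\tau$, the compromised sensor is $n^c$ and it uses attack strategy $\mathfrak{s}$; $E_{\infty,n^c,\mathfrak{s}}$ is the corresponding expectation when the change does not occur. **Performance measures.** For a stopping rule $T$ used by the fusion center to raise an alarm, $$d(T)=\sup_{\tau,\,n^c,\,\mathfrak{s}}\operatorname{ess\,sup}\,E_{\tau,n^c,\mathfrak{s}}[(T-\tau)^+\mid\mathcal{F}_\tau]\quad\text{(detection delay)},$$ $$\mathrm{ARL}(T)=\inf_{n^c,\,\mathfrak{s}}E_{\infty,n^c,\mathfrak{s}}[T]\quad\text{(average run length to false alarm)}.$$ **CUSUM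 rule.** $T_\nu=\inf\{t\ge0: y_t\ge\nu\}$, where $y_t=u_t-m_t$, $u_t=\sum_{n=1}^N\mu\bar\xi^{(n)}_t-\tfrac12N\mu^2t$, and $m_t=\inf_{0\le s\le t}u_s$. *)

theory Defs
  imports "HOL-Probability.Probability"
begin

definition standard_brownian_motion :: "'a measure \<Rightarrow> (real \<Rightarrow> 'a \<Rightarrow> real) \<Rightarrow> bool" where
  "standard_brownian_motion M B \<longleftrightarrow>
     prob_space M \<and>
     (\<forall>t\<ge>0. B t \<in> borel_measurable M) \<and>
     (AE \<omega> in M. B 0 \<omega> = 0) \<and>
     (\<forall>s t. 0 \<le> s \<and> s < t \<longrightarrow>
        distributed M lborel (\<lambda>\<omega>. B t \<omega> - B s \<omega>) (normal_density 0 (sqrt (t - s)))) \<and>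
     (\<forall>(r :: nat \<Rightarrow> real) k. 0 \<le> r 0 \<and> mono r \<longrightarrow>
        prob_space.indep_vars M (\<lambda>_. borel) (\<lambda>i \<omega>. B (r (Suc i)) \<omega> - B (r i) \<omega>) {..<k}) \<and>
     (\<forall>\<omega>\<in>space M. continuous_on {0..} (\<lambda>t. B t \<omega>))"

text \<open>The processes are independent as path-valued random variables.\<close>

definition sensor_noise :: "'a measure \<Rightarrow> nat \<Rightarrow> (nat \<Rightarrow> real \<Rightarrow> 'a \<Rightarrow> real) \<Rightarrow> bool" where
  "sensor_noise M N W \<longleftrightarrow>
     prob_space M \<and>
     (\<forall>n\<in>{1..N}. standard_brownian_motion M (W n)) \<and>
     prob_space.indep_vars M (\<lambda>_. \<Pi>\<^sub>M t\<in>{0::real..}. borel) (\<lambda>n \<omega>. \<lambda>t\<in>{0..}. W n t \<omega>) {1..N}"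

text \<open>Times take values in \<^typ>\<open>ennreal\<close>, whose truncated subtraction is the positive part
  (for a finite subtrahend, or a finite minuend); the change time \<^term>\<open>\<top>\<close> means no change.\<close>

definition observation ::
  "(nat \<Rightarrow> real \<Rightarrow> 'a \<Rightarrow> real) \<Rightarrow> real \<Rightarrow> ennreal \<Rightarrow> nat \<Rightarrow> real \<Rightarrow> 'a \<Rightarrow> real" where
  "observation W \<mu> \<tau> n t \<omega> = \<mu> * enn2real (ennreal t - \<tau>) + W n t \<omega>"

text \<open>An attack strategy turns the path observed at the compromised sensor into the reported path.
  It is not restricted in any way; the dependence on the sample point admits randomisation and
  any further information the attacker may have.\<close>

type_synonym 'a strategy = "(real \<Rightarrow> real) \<Rightarrow> 'a \<Rightarrow> real \<Rightarrow> real"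

type_synonym stopping_rule = "(nat \<Rightarrow> real \<Rightarrow> real) \<Rightarrow> ennreal"

definition report ::
  "(nat \<Rightarrow> real \<Rightarrow> 'a \<Rightarrow> real) \<Rightarrow> real \<Rightarrow> ennreal \<Rightarrow> nat \<Rightarrow> 'a strategy
     \<Rightarrow> nat \<Rightarrow> real \<Rightarrow> 'a \<Rightarrow> real" where
  "report W \<mu> \<tau> nc s n t \<omega> =
     (if n = nc then s (\<lambda>r\<in>{0..}. observation W \<mu> \<tau> nc r \<omega>) \<omega> t else observation W \<mu> \<tau> n t \<omega>)"

text \<open>The alarm time, as a random variable in the scenario \<open>(\<tau>, nc, s)\<close>. All scenarios live on
  the one probability space carrying the noise, so the expectation for a scenario is the
  integral of the correspondingly constructed random variable.\<close>

definition alarm ::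
  "nat \<Rightarrow> (nat \<Rightarrow> real \<Rightarrow> 'a \<Rightarrow> real) \<Rightarrow> real \<Rightarrow> stopping_rule \<Rightarrow> ennreal \<Rightarrow> nat \<Rightarrow> 'a strategy
     \<Rightarrow> 'a \<Rightarrow> ennreal" where
  "alarm N W \<mu> T \<tau> nc s \<omega> = T (\<lambda>n\<in>{1..N}. \<lambda>t\<in>{0..}. report W \<mu> \<tau> nc s n t \<omega>)"

definition expected_alarm ::
  "'a measure \<Rightarrow> nat \<Rightarrow> (nat \<Rightarrow> real \<Rightarrow> 'a \<Rightarrow> real) \<Rightarrow> real \<Rightarrow> stopping_rule \<Rightarrow> ennreal \<Rightarrow> nat
     \<Rightarrow> 'a strategy \<Rightarrow> ennreal" where
  "expected_alarm M N W \<mu> T \<tau> nc s = (\<integral>\<^sup>+\<omega>. alarm N W \<mu> T \<tau> nc s \<omega> \<partial>M)"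

text \<open>Measurability is demanded only to the extent that the expectations and conditional
  expectations in the performance measures are meaningful; reported paths need not be regular.\<close>

definition strategies ::
  "'a measure \<Rightarrow> nat \<Rightarrow> (nat \<Rightarrow> real \<Rightarrow> 'a \<Rightarrow> real) \<Rightarrow> real \<Rightarrow> stopping_rule \<Rightarrow> nat
     \<Rightarrow> 'a strategy set" where
  "strategies M N W \<mu> T nc =
     {s. \<forall>\<tau>. (\<forall>t\<ge>0. report W \<mu> \<tau> nc s nc t \<in> borel_measurable M) \<and>
             alarm N W \<mu> T \<tau> nc s \<in> borel_measurable M}"

definition fusion_info ::
  "'a measure \<Rightarrow> nat \<Rightarrow> (nat \<Rightarrow> real \<Rightarrow> 'a \<Rightarrow> real) \<Rightarrow> real \<Rightarrow> ennreal \<Rightarrow> nat \<Rightarrow> 'a strategy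
     \<Rightarrow> ennreal \<Rightarrow> 'a measure" where
  "fusion_info M N W \<mu> \<tau> nc s t =
     sigma (space M) {report W \<mu> \<tau> nc s n r -` A \<inter> space M | n r A.
       n \<in> {1..N} \<and> 0 \<le> r \<and> ennreal r \<le> t \<and> A \<in> sets borel}"

text \<open>Only finite change times enter the delay: without a change there is nothing to detect,
  and \<open>T - \<tau>\<close> would be undefined on the event that both are infinite.\<close>

definition detection_delay ::
  "'a measure \<Rightarrow> nat \<Rightarrow> (nat \<Rightarrow> real \<Rightarrow> 'a \<Rightarrow> real) \<Rightarrow> real \<Rightarrow> stopping_rule \<Rightarrow> ennreal" where
  "detection_delay M N W \<mu> T =
     (SUP \<tau>\<in>{..<\<top>}. SUP nc\<in>{1..N}. SUP s\<in>strategies M N W \<mu> T nc.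
        esssup M (nn_cond_exp M (fusion_info M N W \<mu> \<tau> nc s \<tau>)
                    (\<lambda>\<omega>. alarm N W \<mu> T \<tau> nc s \<omega> - \<tau>)))"

definition ARL ::
  "'a measure \<Rightarrow> nat \<Rightarrow> (nat \<Rightarrow> real \<Rightarrow> 'a \<Rightarrow> real) \<Rightarrow> real \<Rightarrow> stopping_rule \<Rightarrow> ennreal" where
  "ARL M N W \<mu> T =
     (INF nc\<in>{1..N}. INF s\<in>strategies M N W \<mu> T nc. expected_alarm M N W \<mu> T \<top> nc s)"

definition cusum_u :: "nat \<Rightarrow> real \<Rightarrow> (nat \<Rightarrow> real \<Rightarrow> real) \<Rightarrow> real \<Rightarrow> real" where
  "cusum_u N \<mu> x t = (\<Sum>n=1..N. \<mu> * x n t) - 1/2 * real N * \<mu>\<^sup>2 * t"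

text \<open>The running infimum is extended real because irregular reports may be unbounded below.\<close>

definition cusum_m :: "nat \<Rightarrow> real \<Rightarrow> (nat \<Rightarrow> real \<Rightarrow> real) \<Rightarrow> real \<Rightarrow> ereal" where
  "cusum_m N \<mu> x t = (INF s\<in>{0..t}. ereal (cusum_u N \<mu> x s))"

definition cusum_y :: "nat \<Rightarrow> real \<Rightarrow> (nat \<Rightarrow> real \<Rightarrow> real) \<Rightarrow> real \<Rightarrow> ereal" where
  "cusum_y N \<mu> x t = ereal (cusum_u N \<mu> x t) - cusum_m N \<mu> x t"

definition cusum :: "nat \<Rightarrow> real \<Rightarrow> real \<Rightarrow> stopping_rule" where
  "cusum N \<mu> \<nu> x = (INF t\<in>{t. 0 \<le> t \<and> ereal \<nu> \<le> cusum_y N \<mu> x t}. ennreal t)"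

definition attack :: "nat \<Rightarrow> (nat \<Rightarrow> real \<Rightarrow> 'a \<Rightarrow> real) \<Rightarrow> real \<Rightarrow> 'a strategy" where
  "attack N W \<mu> x \<omega> t = real N * \<mu> * t + W 1 t \<omega>"

end

theory Submission
  imports Defs
begin

text \<open>
  Under the attack the CUSUM process \<open>u\<close> is a Brownian motion of variance \<open>2a\<close> per unit time with
  upward drift, where \<open>a = N \<mu>\<^sup>2 / 2\<close>: the drift is \<open>a\<close> if no change occurs and
  \<open>b = (3N/2 - 1) \<mu>\<^sup>2\<close> if the change occurs at time \<open>0\<close>. The alarm is raised when \<open>u\<close> first stands
  \<open>\<nu>\<close> above its running minimum, that is, when the reflected motion \<open>y\<close> reaches \<open>\<nu>\<close>. The function
  \<open>f(y) = exp (- y) + y - 1\<close> satisfies \<open>f'(0) = 0\<close> and is mapped by the generator \<open>a f'' + b f'\<close> to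
  \<open>a exp (- y) + b (1 - exp (- y))\<close>, which equals \<open>a\<close> if \<open>b = a\<close> and is at most \<open>b\<close> if \<open>b \<ge> a\<close>. By
  Dynkin's formula \<open>E[T] = f(\<nu>) / a\<close> in the first case and \<open>E[T] \<ge> f(\<nu>) / b\<close> in the second. As
  \<open>\<nu>\<close> grows, the expected alarm time after an immediate change is thus at least a fixed fraction
  \<open>a / b\<close> of the one without change, so the delay grows at least linearly in the average run length.

  The argument is carried out along grids of mesh \<open>h\<close>, where Dynkin's formula becomes a
  telescoping sum for a reflected Gaussian walk. Since \<open>f(y + x)\<close> is a sum of products of functions
  of \<open>y\<close> and of \<open>x\<close>, its mean over one step can be computed from the exponential moments of the
  step. Reflection works in favour of the lower bound, which thus holds for every mesh
  (\<open>expected_walk_time_ge\<close>). For the upper bound \<open>f\<close> is tilted to \<open>f(y) + \<epsilon> y\<close>, whose slope at the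
  boundary outweighs the cost of reflection when \<open>h\<close> is small (\<open>expected_walk_time_le\<close>).

  Passing to continuous time is a matter of paths. Sampling delays the alarm, so the upper bound is
  inherited directly. By continuity the alarm time for \<open>\<nu>\<close> is at least the limit of the dyadic alarm
  times for any lower level (\<open>drawup_time_dyadic\<close>), and monotone convergence gives the lower bound.
  The finite expectation that this requires holds for drift \<open>a\<close> by the upper bound, and for drift
  \<open>b\<close> since more drift means an earlier alarm. The same pathwise comparison bounds the expected
  alarm time after an immediate change by the one without change.
\<close>

section \<open>Draw-up times\<close>

text \<open>The first time in \<open>G\<close> at which the path stands at least \<open>\<nu>\<close> above one of its earlier values.
  Because \<open>G\<close> is a parameter, the same notion covers continuous time and sampling along a grid,
  and sampling can only delay the draw-up.\<close>

definition drawup_time :: "real set \<Rightarrow> (real \<Rightarrow> real) \<Rightarrow> real \<Rightarrow> ennreal" where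
  "drawup_time G u \<nu> = (INF t\<in>{t\<in>G. \<exists>s\<in>G. s \<le> t \<and> \<nu> \<le> u t - u s}. ennreal t)"

definition grid :: "real \<Rightarrow> real set" where
  "grid h = range (\<lambda>k::nat. real k * h)"

lemma drawup_time_le:
  "s \<in> G \<Longrightarrow> t \<in> G \<Longrightarrow> s \<le> t \<Longrightarrow> \<nu> \<le> u t - u s \<Longrightarrow> drawup_time G u \<nu> \<le> ennreal t"
  unfolding drawup_time_def by (rule INF_lower) auto

lemma drawup_time_greatest:
  assumes "\<And>s t. s \<in> G \<Longrightarrow> t \<in> G \<Longrightarrow> s \<le> t \<Longrightarrow> \<nu> \<le> u t - u s \<Longrightarrow> c \<le> ennreal t"
  shows "c \<le> drawup_time G u \<nu>"
  unfolding drawup_time_def by (rule INF_greatest) (use assms in auto)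

lemma drawup_time_mono:
  assumes "G \<subseteq> G'"
    and "\<And>s t. s \<in> G \<Longrightarrow> t \<in> G \<Longrightarrow> s \<le> t \<Longrightarrow> \<nu> \<le> u t - u s \<Longrightarrow> \<nu>' \<le> u' t - u' s"
  shows "drawup_time G' u' \<nu>' \<le> drawup_time G u \<nu>"
  by (rule drawup_time_greatest, rule drawup_time_le) (use assms in auto)

lemma drawup_time_cong:
  assumes "\<And>t. t \<in> G \<Longrightarrow> u t = u' t"
  shows "drawup_time G u \<nu> = drawup_time G u' \<nu>"
  by (intro antisym drawup_time_mono) (auto simp: assms)

lemma grid_nonneg: "0 \<le> h \<Longrightarrow> grid h \<subseteq> {0..}"
  by (auto simp: grid_def)

lemma grid_refine: "grid ((1/2) ^ j) \<subseteq> grid ((1/2) ^ Suc j)"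
proof
  fix t :: real assume "t \<in> grid ((1/2) ^ j)"
  then obtain k :: nat where "t = real k * (1/2) ^ j" by (auto simp: grid_def)
  then have "t = real (2 * k) * (1/2) ^ Suc j" by simp
  then show "t \<in> grid ((1/2) ^ Suc j)" unfolding grid_def by blast
qed

lemma dyadic_approximation:
  fixes x :: real
  assumes "0 \<le> x"
  defines "r \<equiv> \<lambda>j. real (nat \<lceil>x * 2 ^ j\<rceil>) * (1/2) ^ j"
  shows "r \<longlonglongrightarrow> x"
proof (rule tendsto_sandwich)
  have "x \<le> r j \<and> r j \<le> x + (1/2) ^ j" for j
  proof -
    have "real (nat \<lceil>x * 2 ^ j\<rceil>) = of_int \<lceil>x * 2 ^ j\<rceil>"
      using assms(1) by simp
    moreover have "x * 2 ^ j \<le> of_int \<lceil>x * 2 ^ j\<rceil>" "of_int \<lceil>x * 2 ^ j\<rceil> \<le> x * 2 ^ j + 1"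
      by linarith+
    ultimately show ?thesis
      unfolding r_def by (simp add: field_simps)
  qed
  then show "\<forall>\<^sub>F j in sequentially. x \<le> r j" "\<forall>\<^sub>F j in sequentially. r j \<le> x + (1/2) ^ j"
    by auto
  have "(\<lambda>j. x + (1/2::real) ^ j) \<longlonglongrightarrow> x + 0"
    by (intro tendsto_intros LIMSEQ_power_zero) auto
  then show "(\<lambda>j. x + (1/2::real) ^ j) \<longlonglongrightarrow> x" by simp
qed simp

text \<open>Sampling finely enough catches every draw-up if the level is lowered a little: rounding the two
  times of a draw-up of height \<open>\<nu>\<close> up to the grid changes its height by an amount that vanishes
  with the mesh, by continuity, and delays its end by at most one mesh width.\<close>

lemma drawup_time_dyadic:
  assumes cont: "continuous_on {0..} u" and less: "\<nu>' < \<nu>"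
  shows "(INF j. drawup_time (grid ((1/2) ^ j)) u \<nu>') \<le> drawup_time {0..} u \<nu>"
proof (rule drawup_time_greatest)
  fix s t :: real
  assume st: "s \<in> {0..}" "t \<in> {0..}" "s \<le> t" "\<nu> \<le> u t - u s"
  define r where "r = (\<lambda>(x::real) j. real (nat \<lceil>x * 2 ^ j\<rceil>) * (1/2::real) ^ j)"
  have lim: "r x \<longlonglongrightarrow> x" if "0 \<le> x" for x :: real
    unfolding r_def using dyadic_approximation[OF that] .
  have grid: "r x j \<in> grid ((1/2) ^ j)" for x j
    unfolding r_def grid_def by blast
  have rpos: "0 \<le> r x j" for x j by (simp add: r_def)
  have ulim: "(\<lambda>j. u (r x j)) \<longlonglongrightarrow> u x" if "0 \<le> x" for x
    by (rule continuous_on_tendsto_compose[OF cont lim]) (use that rpos in auto)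
  have "(\<lambda>j. u (r t j) - u (r s j)) \<longlonglongrightarrow> u t - u s"
    using st by (intro tendsto_diff ulim) auto
  then have "\<forall>\<^sub>F j in sequentially. \<nu>' < u (r t j) - u (r s j)"
    by (rule order_tendstoD) (use st less in linarith)
  then have "\<forall>\<^sub>F j in sequentially. (INF j. drawup_time (grid ((1/2) ^ j)) u \<nu>') \<le> ennreal (r t j)"
  proof eventually_elim
    case (elim j)
    have "r s j \<le> r t j"
      using st(3) unfolding r_def by (intro mult_right_mono of_nat_mono nat_mono ceiling_mono) auto
    then have "drawup_time (grid ((1/2) ^ j)) u \<nu>' \<le> ennreal (r t j)"
      using elim by (intro drawup_time_le[OF grid grid]) auto
    then show ?case by (meson INF_lower UNIV_I order_trans)
  qed
  moreover have "(\<lambda>j. ennreal (r t j)) \<longlonglongrightarrow> ennreal t"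
    using st by (intro tendsto_ennrealI lim) auto
  ultimately show "(INF j. drawup_time (grid ((1/2) ^ j)) u \<nu>') \<le> ennreal t"
    by (intro tendsto_lowerbound[where F=sequentially]) auto
qed

text \<open>If draw-ups of heights \<open>\<nu> - 1/(i+1)\<close> have all ended by about time \<open>c\<close>, then their start and
  end points accumulate, by compactness, at a draw-up of height \<open>\<nu>\<close> that has ended by time \<open>c\<close>.\<close>

lemma drawup_time_left_continuous:
  assumes cont: "continuous_on {0..} u"
  shows "drawup_time {0..} u \<nu> \<le> (SUP i. drawup_time {0..} u (\<nu> - 1 / real (Suc i)))"
    (is "_ \<le> ?S")
proof (cases ?S)
  case (real c)
  have "\<exists>s t. 0 \<le> s \<and> s \<le> t \<and> t \<le> c + 1 / real (Suc i) \<and> \<nu> - 1 / real (Suc i) \<le> u t - u s" for i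
  proof -
    have "drawup_time {0..} u (\<nu> - 1 / real (Suc i)) \<le> ?S" by (rule SUP_upper) simp
    also have "\<dots> < ennreal (c + 1 / real (Suc i))"
      unfolding real(2) using real(1) by (intro ennreal_lessI) (auto intro: add_nonneg_pos)
    finally have "drawup_time {0..} u (\<nu> - 1 / real (Suc i)) < ennreal (c + 1 / real (Suc i))" .
    then obtain s t where "0 \<le> s" "s \<le> t" "\<nu> - 1 / real (Suc i) \<le> u t - u s"
        "ennreal t < ennreal (c + 1 / real (Suc i))"
      unfolding drawup_time_def Inf_less_iff by auto
    moreover from this have "t \<le> c + 1 / real (Suc i)"
      by (simp add: ennreal_less_iff)
    ultimately show ?thesis by blast
  qed
  then obtain s t where st: "\<And>i. 0 \<le> s i" "\<And>i. s i \<le> t i" "\<And>i. t i \<le> c + 1 / real (Suc i)"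
      "\<And>i. \<nu> - 1 / real (Suc i) \<le> u (t i) - u (s i)"
    by metis
  have "t i \<le> c + 1" for i using st(3)[of i] by (rule order_trans) (simp add: field_simps)
  then have "\<forall>i. (s i, t i) \<in> {0..c+1} \<times> {0..c+1}"
    using st(1,2) by (auto intro: order_trans)
  moreover have "compact ({0..c+1} \<times> {0..c+1})" by (intro compact_Times compact_Icc)
  ultimately obtain p r where p: "p \<in> {0..c+1} \<times> {0..c+1}"
      and r: "strict_mono r" and lim: "((\<lambda>i. (s i, t i)) \<circ> r) \<longlonglongrightarrow> p"
    unfolding compact_def by (metis (no_types, lifting))
  obtain s0 t0 where p0: "p = (s0, t0)" by fastforce
  have ls: "(\<lambda>i. s (r i)) \<longlonglongrightarrow> s0" and lt: "(\<lambda>i. t (r i)) \<longlonglongrightarrow> t0"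
    using tendsto_fst[OF lim] tendsto_snd[OF lim] by (auto simp: p0 o_def)
  have inv: "(\<lambda>i. 1 / real (Suc (r i))) \<longlonglongrightarrow> 0"
    using LIMSEQ_subseq_LIMSEQ[OF LIMSEQ_inverse_real_of_nat r] by (simp add: o_def inverse_eq_divide)
  have pos: "0 \<le> s0" "0 \<le> t0" using p by (auto simp: p0)
  have "s0 \<le> t0" by (rule tendsto_le[OF _ lt ls]) (auto simp: st)
  moreover have "t0 \<le> c"
  proof (rule tendsto_le[OF _ _ lt])
    show "(\<lambda>i. c + 1 / real (Suc (r i))) \<longlonglongrightarrow> c"
      using tendsto_add[OF tendsto_const inv, of c] by simp
  qed (use st(3) in auto)
  moreover have "\<nu> \<le> u t0 - u s0"
  proof (rule tendsto_le)
    show "(\<lambda>i. \<nu> - 1 / real (Suc (r i))) \<longlonglongrightarrow> \<nu>"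
      using tendsto_diff[OF tendsto_const inv, of \<nu>] by simp
    have "t (r i) \<in> {0..}" for i using st(1,2)[of "r i"] by simp
    then show "(\<lambda>i. u (t (r i)) - u (s (r i))) \<longlonglongrightarrow> u t0 - u s0"
      using pos st(1)
      by (intro tendsto_diff continuous_on_tendsto_compose[OF cont lt]
          continuous_on_tendsto_compose[OF cont ls]) auto
  qed (use st(4) in auto)
  ultimately have "drawup_time {0..} u \<nu> \<le> ennreal t0"
    using pos by (intro drawup_time_le) auto
  also have "\<dots> \<le> ennreal c" using \<open>t0 \<le> c\<close> by (rule ennreal_leI)
  finally show ?thesis unfolding real(2) .
next
  case top
  then show ?thesis by (metis top_greatest)
qed

text \<open>This expresses the draw-up time through countably many sampled values, and so makes it
  measurable.\<close>

lemma drawup_time_eq_SUP_INF_dyadic: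
  assumes "continuous_on {0..} u"
  shows "drawup_time {0..} u \<nu> =
    (SUP i. INF j. drawup_time (grid ((1/2) ^ j)) u (\<nu> - 1 / real (Suc i)))"
proof (rule antisym)
  have "drawup_time {0..} u \<nu> \<le> (SUP i. drawup_time {0..} u (\<nu> - 1 / real (Suc i)))"
    by (rule drawup_time_left_continuous[OF assms])
  also have "\<dots> \<le> (SUP i. INF j. drawup_time (grid ((1/2) ^ j)) u (\<nu> - 1 / real (Suc i)))"
    by (intro SUP_mono' INF_greatest drawup_time_mono grid_nonneg) auto
  finally show "drawup_time {0..} u \<nu> \<le> \<dots>" .
  show "\<dots> \<le> drawup_time {0..} u \<nu>"
    by (intro SUP_least drawup_time_dyadic assms) simp
qed

lemma measurable_drawup_time_countable:
  assumes "countable G" and [measurable]: "\<And>t. t \<in> G \<Longrightarrow> X t \<in> borel_measurable M"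
  shows "(\<lambda>\<omega>. drawup_time G (\<lambda>t. X t \<omega>) \<nu>) \<in> borel_measurable M"
proof -
  have "drawup_time G u \<nu> = (INF t\<in>G. INF s\<in>G. if s \<le> t \<and> \<nu> \<le> u t - u s then ennreal t else \<top>)"
    for u
  proof (rule antisym)
    show "drawup_time G u \<nu> \<le> (INF t\<in>G. INF s\<in>G. if s \<le> t \<and> \<nu> \<le> u t - u s then ennreal t else \<top>)"
      by (intro INF_greatest) (simp add: drawup_time_le)
    show "(INF t\<in>G. INF s\<in>G. if s \<le> t \<and> \<nu> \<le> u t - u s then ennreal t else \<top>) \<le> drawup_time G u \<nu>"
    proof (rule drawup_time_greatest)
      fix s t assume "s \<in> G" "t \<in> G" "s \<le> t" "\<nu> \<le> u t - u s"
      then show "(INF t\<in>G. INF s\<in>G. if s \<le> t \<and> \<nu> \<le> u t - u s then ennreal t else \<top>) \<le> ennreal t"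
        by (intro INF_lower2[of t] INF_lower2[of s]) auto
    qed
  qed
  then show ?thesis
    by (simp only:) (intro borel_measurable_INF assms(1), measurable)
qed

lemma measurable_drawup_time_grid:
  assumes "0 \<le> h" "\<And>t. 0 \<le> t \<Longrightarrow> X t \<in> borel_measurable M"
  shows "(\<lambda>\<omega>. drawup_time (grid h) (\<lambda>t. X t \<omega>) \<nu>) \<in> borel_measurable M"
  using grid_nonneg[OF assms(1)] assms(2)
  by (intro measurable_drawup_time_countable) (auto simp: grid_def)

lemma measurable_drawup_time:
  assumes [measurable]: "\<And>t. 0 \<le> t \<Longrightarrow> X t \<in> borel_measurable M"
    and cont: "\<And>\<omega>. \<omega> \<in> space M \<Longrightarrow> continuous_on {0..} (\<lambda>t. X t \<omega>)"
  shows "(\<lambda>\<omega>. drawup_time {0..} (\<lambda>t. X t \<omega>) \<nu>) \<in> borel_measurable M"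
proof -
  have [measurable]: "(\<lambda>\<omega>. drawup_time (grid ((1/2) ^ j)) (\<lambda>t. X t \<omega>) \<nu>) \<in> borel_measurable M" for j \<nu>
    by (intro measurable_drawup_time_grid) auto
  have "(\<lambda>\<omega>. SUP i. INF j. drawup_time (grid ((1/2) ^ j)) (\<lambda>t. X t \<omega>) (\<nu> - 1 / real (Suc i)))
      \<in> borel_measurable M"
    by measurable
  then show ?thesis
    by (rule measurable_cong[THEN iffD2, rotated]) (intro drawup_time_eq_SUP_INF_dyadic cont)
qed

text \<open>A continuous path attains its running infimum, so exceeding the infimum by \<open>\<nu>\<close> is the same as
  exceeding some earlier value by \<open>\<nu>\<close>.\<close>

lemma cusum_eq_drawup_time:
  assumes cont: "continuous_on {0..} (cusum_u N \<mu> x)"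
  shows "cusum N \<mu> \<nu> x = drawup_time {0..} (cusum_u N \<mu> x) \<nu>"
proof -
  let ?u = "cusum_u N \<mu> x"
  have "ereal \<nu> \<le> cusum_y N \<mu> x t \<longleftrightarrow> (\<exists>s\<in>{0..}. s \<le> t \<and> \<nu> \<le> ?u t - ?u s)" if t: "0 \<le> t" for t
  proof -
    have "continuous_on {0..t} ?u" by (rule continuous_on_subset[OF cont]) auto
    then obtain s where s: "s \<in> {0..t}" "\<And>r. r \<in> {0..t} \<Longrightarrow> ?u s \<le> ?u r"
      using continuous_attains_inf[of "{0..t}" ?u] t by auto
    have "cusum_m N \<mu> x t = ereal (?u s)"
      unfolding cusum_m_def by (intro antisym INF_lower INF_greatest) (use s in auto)
    then have "cusum_y N \<mu> x t = ereal (?u t - ?u s)" by (simp add: cusum_y_def)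
    then show ?thesis using s by force
  qed
  then have "{t. 0 \<le> t \<and> ereal \<nu> \<le> cusum_y N \<mu> x t}
      = {t\<in>{0..}. \<exists>s\<in>{0..}. s \<le> t \<and> \<nu> \<le> ?u t - ?u s}" by auto
  then show ?thesis unfolding cusum_def drawup_time_def by simp
qed

section \<open>Draw-ups along a grid as passage times of a reflected walk\<close>

text \<open>Lindley's recursion for the height of a random walk above its running minimum, frozen at the
  first passage of \<open>\<nu>\<close>. Freezing makes the passage time equal to the number of \<open>k\<close> with the walk
  below \<open>\<nu>\<close>, and keeps bounded functions of the walk telescoping without reference to that time.\<close>

primrec stopped_walk :: "real \<Rightarrow> (nat \<Rightarrow> real) \<Rightarrow> nat \<Rightarrow> real" where
  "stopped_walk \<nu> x 0 = 0"
| "stopped_walk \<nu> x (Suc k) =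
     (let y = stopped_walk \<nu> x k in if y < \<nu> then max 0 (y + x k) else y)"

lemma stopped_walk_nonneg: "0 \<le> stopped_walk \<nu> x k"
  by (induction k) (auto simp: Let_def)

lemma stopped_walk_below:
  "stopped_walk \<nu> x k < \<nu> \<Longrightarrow> j \<le> k \<Longrightarrow> stopped_walk \<nu> x j < \<nu>"
  by (induction k) (auto simp: Let_def le_Suc_eq split: if_splits)

lemma stopped_walk_ge_sum:
  "stopped_walk \<nu> x k < \<nu> \<Longrightarrow> i \<le> k \<Longrightarrow> sum x {i..<k} \<le> stopped_walk \<nu> x k"
proof (induction k)
  case (Suc k)
  have *: "stopped_walk \<nu> x k < \<nu>" using Suc.prems(1) stopped_walk_below[of \<nu> x "Suc k" k] by simp
  show ?case
  proof (cases "i = Suc k")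
    case True
    then show ?thesis using stopped_walk_nonneg[of \<nu> x "Suc k"] by simp
  next
    case False
    then have "sum x {i..<k} \<le> stopped_walk \<nu> x k" "sum x {i..<Suc k} = sum x {i..<k} + x k"
      using Suc.IH[OF *] Suc.prems(2) by auto
    then show ?thesis using * by (simp add: Let_def)
  qed
qed simp

lemma stopped_walk_eq_sum: "\<exists>i j. i \<le> j \<and> j \<le> k \<and> stopped_walk \<nu> x k = sum x {i..<j}"
proof (induction k)
  case (Suc k)
  show ?case
  proof (cases "stopped_walk \<nu> x k < \<nu> \<and> 0 \<le> stopped_walk \<nu> x k + x k")
    case True
    then have walk: "stopped_walk \<nu> x j < \<nu>" if "j \<le> k" for j
      using stopped_walk_below that by blast
    \<comment> \<open>An unstopped walk accumulates increments up to the present, so the interval ends at k.\<close>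
    have "\<exists>i\<le>j. stopped_walk \<nu> x j = sum x {i..<j}" if "j \<le> k" for j using that
    proof (induction j)
      case (Suc j)
      then obtain i where i: "i \<le> j" "stopped_walk \<nu> x j = sum x {i..<j}" by auto
      show ?case
      proof (cases "0 \<le> stopped_walk \<nu> x j + x j")
        case True
        then show ?thesis using i walk[of j] Suc.prems by (intro exI[of _ i]) (simp add: Let_def)
      next
        case False
        then show ?thesis using walk[of j] Suc.prems by (intro exI[of _ "Suc j"]) (simp add: Let_def)
      qed
    qed simp
    then obtain i where "i \<le> k" "stopped_walk \<nu> x k = sum x {i..<k}" by blast
    then show ?thesis using True by (intro exI[of _ i] exI[of _ "Suc k"]) (simp add: Let_def)
  next
    case False
    show ?thesis
    proof (cases "stopped_walk \<nu> x k < \<nu>")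
      case True
      then show ?thesis using False by (intro exI[of _ 0]) (simp add: Let_def)
    next
      case False
      then show ?thesis using Suc.IH by (simp add: Let_def) (meson le_SucI)
    qed
  qed
qed simp

text \<open>Before it is frozen the walk is the largest draw-up that ends at the present step. Hence it
  passes \<open>\<nu>\<close> exactly when the first draw-up of height \<open>\<nu>\<close> ends, and every earlier step
  contributes one mesh width.\<close>

lemma drawup_time_grid_eq_suminf:
  fixes u :: "real \<Rightarrow> real"
  assumes h: "0 < h"
  defines "x \<equiv> \<lambda>k. u (real (Suc k) * h) - u (real k * h)"
  shows "drawup_time (grid h) u \<nu> = (\<Sum>k. ennreal h * indicator {..<\<nu>} (stopped_walk \<nu> x k))"
proof -
  have tele: "sum x {i..<j} = u (real j * h) - u (real i * h)" if "i \<le> j" for i j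
    unfolding x_def using that by (rule sum_Suc_diff')
  have late: "\<nu> \<le> stopped_walk \<nu> x k" if "i \<le> k" "\<nu> \<le> u (real k * h) - u (real i * h)" for i k
    using stopped_walk_ge_sum[of \<nu> x k i] that tele[OF that(1)] by linarith
  show ?thesis
  proof (cases "\<exists>k. \<nu> \<le> stopped_walk \<nu> x k")
    case True
    define K where "K = (LEAST k. \<nu> \<le> stopped_walk \<nu> x k)"
    have K: "\<nu> \<le> stopped_walk \<nu> x K" unfolding K_def using True by (rule LeastI_ex)
    have K_le: "k < K \<longleftrightarrow> stopped_walk \<nu> x k < \<nu>" for k
      using K stopped_walk_below[of \<nu> x k K] not_less_Least[of k] unfolding K_def
      by (metis linorder_not_less)
    have "(\<Sum>k. ennreal h * indicator {..<\<nu>} (stopped_walk \<nu> x k)) = (\<Sum>k<K. ennreal h)"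
      by (subst suminf_finite[of "{..<K}"]) (auto simp: K_le)
    also have "\<dots> = ennreal (real K * h)"
      using h by (simp add: ennreal_of_nat_eq_real_of_nat ennreal_mult)
    also have "\<dots> = drawup_time (grid h) u \<nu>"
    proof (rule antisym)
      show "ennreal (real K * h) \<le> drawup_time (grid h) u \<nu>"
      proof (rule drawup_time_greatest)
        fix s t assume "s \<in> grid h" "t \<in> grid h" "s \<le> t" and up: "\<nu> \<le> u t - u s"
        then obtain i k where "s = real i * h" and t: "t = real k * h" and "i \<le> k"
          using h by (auto simp: grid_def)
        then have "\<nu> \<le> stopped_walk \<nu> x k" using late up by blast
        then have "K \<le> k" using K_le[of k] by simp
        then show "ennreal (real K * h) \<le> ennreal t"
          using h unfolding t by (intro ennreal_leI) simp
      qed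
      obtain i j where ij: "i \<le> j" "j \<le> K" "stopped_walk \<nu> x K = sum x {i..<j}"
        using stopped_walk_eq_sum by blast
      then have "drawup_time (grid h) u \<nu> \<le> ennreal (real j * h)"
        using K tele[OF ij(1)] h by (intro drawup_time_le[of "real i * h"]) (auto simp: grid_def)
      also have "\<dots> \<le> ennreal (real K * h)" using ij h by (intro ennreal_leI) simp
      finally show "drawup_time (grid h) u \<nu> \<le> ennreal (real K * h)" .
    qed
    finally show ?thesis ..
  next
    case False
    then have below: "stopped_walk \<nu> x k < \<nu>" for k by (meson not_le)
    have "\<top> \<le> drawup_time (grid h) u \<nu>"
    proof (rule drawup_time_greatest)
      fix s t assume "s \<in> grid h" "t \<in> grid h" "s \<le> t" and up: "\<nu> \<le> u t - u s"
      then obtain i k where "s = real i * h" "t = real k * h" "i \<le> k"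
        using h by (auto simp: grid_def)
      then have "\<nu> \<le> stopped_walk \<nu> x k" using late up by blast
      then show "\<top> \<le> ennreal t" using below[of k] by simp
    qed
    moreover have "(\<Sum>k. ennreal h * indicator {..<\<nu>} (stopped_walk \<nu> x k))
        = (\<integral>\<^sup>+k. ennreal h \<partial>count_space (UNIV :: nat set))"
      using below by (simp only: nn_integral_count_space_nat) simp
    moreover have "\<dots> = ennreal h * \<top>" by (subst nn_integral_const) simp
    moreover have "\<dots> = \<top>" using h by (simp add: ennreal_mult_top)
    ultimately show ?thesis by (simp add: top_unique)
  qed
qed

section \<open>The solution of the generator equation\<close>

text \<open>The solution of \<open>f'' + f' = 1\<close> with \<open>f(0) = f'(0) = 0\<close>. The generator of Brownian motion with
  drift \<open>a\<close> and variance \<open>2a\<close> per unit time is \<open>a (f'' + f')\<close>, and reflection at \<open>0\<close> calls for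
  \<open>f'(0) = 0\<close>; so Dynkin's formula gives the expected passage time of the reflected motion
  over \<open>\<nu>\<close> as \<open>f(\<nu>) / a\<close>.\<close>

definition dynkin :: "real \<Rightarrow> real" where
  "dynkin y = exp (- y) + y - 1"

lemma dynkin_nonneg: "0 \<le> dynkin y"
  using exp_ge_add_one_self[of "- y"] by (simp add: dynkin_def)

lemma dynkin_0 [simp]: "dynkin 0 = 0"
  by (simp add: dynkin_def)

lemma measurable_dynkin [measurable]: "dynkin \<in> borel_measurable borel"
  unfolding dynkin_def by measurable

lemma dynkin_mono:
  assumes "0 \<le> y" "y \<le> z"
  shows "dynkin y \<le> dynkin z"
proof -
  have "exp (- y) - exp (- z) = exp (- y) * (1 - exp (- (z - y)))"
    by (simp add: algebra_simps flip: exp_add)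
  also have "\<dots> \<le> 1 * (z - y)"
    using assms exp_minus_ge[of "z - y"] by (intro mult_mono) (auto simp del: exp_ge_add_one_self)
  finally show ?thesis by (simp add: dynkin_def)
qed

text \<open>Increments of the function split into products of a function of the position and a function of
  the step. Expectations of steps of a walk thus need only \<open>E[XY] = E[X] E[Y]\<close>.\<close>

lemma dynkin_add: "dynkin (y + x) = dynkin y + exp (- y) * (exp (- x) - 1) + x"
  by (simp add: dynkin_def algebra_simps flip: exp_add)

text \<open>Reflection at \<open>0\<close> and truncation at \<open>\<nu>\<close> only decrease the function, whose minimum over the whole
  line is at \<open>0\<close>. No error term arises in this direction.\<close>

lemma dynkin_step_le:
  assumes "0 < \<nu>"
  shows "dynkin (min (max 0 (y + x)) \<nu>) \<le> dynkin y + exp (- y) * (exp (- x) - 1) + x"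
  unfolding dynkin_add[symmetric]
proof (cases "0 \<le> y + x")
  case True
  then show "dynkin (min (max 0 (y + x)) \<nu>) \<le> dynkin (y + x)"
    using assms by (intro dynkin_mono) auto
next
  case False
  then show "dynkin (min (max 0 (y + x)) \<nu>) \<le> dynkin (y + x)"
    using assms dynkin_nonneg[of "y + x"] by (simp add: max_def min_def)
qed

lemma dynkin_tilted_mono:
  assumes "0 \<le> \<epsilon>" "0 \<le> y" "y \<le> z"
  shows "dynkin y + \<epsilon> * y \<le> dynkin z + \<epsilon> * z"
  using assms by (intro add_mono mult_left_mono dynkin_mono)

lemma le_fourth_power:
  fixes q \<epsilon> :: real
  assumes "0 < \<epsilon>" "\<epsilon> \<le> q"
  shows "q \<le> q ^ 4 / \<epsilon> ^ 3"
proof -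
  have "q * \<epsilon> ^ 3 \<le> q * q ^ 3"
    using assms by (intro mult_left_mono power_mono) auto
  also have "q * q ^ 3 = q ^ 4" using power_Suc[of q 3] by simp
  finally show ?thesis using assms by (simp add: pos_le_divide_eq)
qed

text \<open>In the opposite direction reflection costs about \<open>x\<^sup>2 / 2\<close>, which is of the same order as the
  drift over one step. The tilt \<open>\<epsilon> * y\<close> has positive slope at the boundary and so pays for all
  reflections by at most \<open>\<epsilon>\<close>. Reflections by more than \<open>\<epsilon>\<close> and overshoots beyond \<open>\<nu> + \<epsilon>\<close>
  require a step larger than \<open>\<epsilon>\<close> and are absorbed by fourth powers, whose expectations are of second
  order in the mesh. The fourth powers are taken of \<open>exp x - 1\<close> and \<open>exp (- x) - 1\<close> so that only exponential moments matter.\<close>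

lemma dynkin_tilted_step_ge:
  fixes \<epsilon> :: real
  assumes \<epsilon>: "0 < \<epsilon>" "\<epsilon> \<le> 1" and y: "0 \<le> y" "y < \<nu>"
  defines "G \<equiv> \<lambda>y. dynkin y + \<epsilon> * y"
  shows "G y + exp (- y) * (exp (- x) - 1) + (1 + \<epsilon>) * x
      - 2 / \<epsilon> ^ 3 * ((exp (- x) - 1) ^ 4 + (exp x - 1) ^ 4)
    \<le> G (min (max 0 (y + x)) (\<nu> + \<epsilon>))"
proof -
  define z where "z = y + x"
  define A where "A = (exp (- x) - 1) ^ 4"
  define B where "B = (exp x - 1) ^ 4"
  have AB: "0 \<le> A" "0 \<le> B" by (auto simp: A_def B_def)
  then have AB': "0 \<le> A / \<epsilon> ^ 3" "0 \<le> B / \<epsilon> ^ 3" using \<epsilon> by auto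
  have [simp]: "G 0 = 0" by (simp add: G_def)
  have "G z \<le> G (min (max 0 z) (\<nu> + \<epsilon>)) + 2 * (A / \<epsilon> ^ 3) + 2 * (B / \<epsilon> ^ 3)"
  proof -
    consider "z < 0" | "0 \<le> z" "z \<le> \<nu> + \<epsilon>" | "\<nu> + \<epsilon> < z" by linarith
    then show ?thesis
    proof cases
      case 1
      define w where "w = - z"
      have w: "0 < w" "w \<le> - x" using 1 y by (auto simp: w_def z_def)
      have "G z \<le> (exp w - 1) ^ 4 / \<epsilon> ^ 3"
      proof (cases "w \<le> \<epsilon>")
        case True
        \<comment> \<open>A reflection by at most \<open>\<epsilon>\<close> is paid for by the slope of the tilt.\<close>
        then have "exp w \<le> 1 + w + w\<^sup>2" using w \<epsilon> by (intro exp_bound) auto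
        moreover have "w\<^sup>2 \<le> \<epsilon> * w" unfolding power2_eq_square
          using True w by (intro mult_right_mono) auto
        ultimately have "G z \<le> 0" by (simp add: G_def dynkin_def w_def)
        moreover have "0 \<le> (exp w - 1) ^ 4 / \<epsilon> ^ 3" using \<epsilon> by simp
        ultimately show ?thesis by linarith
      next
        case False
        then have "exp w - 1 \<le> (exp w - 1) ^ 4 / \<epsilon> ^ 3"
          using \<epsilon> exp_ge_add_one_self[of w] by (intro le_fourth_power) linarith+
        moreover have "0 \<le> \<epsilon> * w" using \<epsilon> w by simp
        ultimately show ?thesis using w by (simp add: G_def dynkin_def w_def)
      qed
      also have "\<dots> \<le> A / \<epsilon> ^ 3"
        unfolding A_def using w \<epsilon> by (intro divide_right_mono power_mono) auto
      finally show ?thesis using 1 y \<epsilon> AB' by (simp add: max_def min_def)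
    next
      case 2
      then show ?thesis using AB' by (simp add: max_def min_def)
    next
      case 3
      have x: "\<epsilon> < x" "z - (\<nu> + \<epsilon>) < x" using 3 y \<epsilon> by (auto simp: z_def)
      have "dynkin z - dynkin (\<nu> + \<epsilon>) \<le> z - (\<nu> + \<epsilon>)"
        using 3 by (simp add: dynkin_def)
      then have "G z - G (\<nu> + \<epsilon>) \<le> (1 + \<epsilon>) * (z - (\<nu> + \<epsilon>))"
        by (simp add: G_def algebra_simps)
      also have "\<dots> \<le> 2 * (z - (\<nu> + \<epsilon>))"
        using \<epsilon> 3 by (intro mult_right_mono) auto
      also have "\<dots> \<le> 2 * (exp x - 1)" 
        using x exp_ge_add_one_self[of x] by (intro mult_left_mono) linarith+
      also have "\<dots> \<le> 2 * (B / \<epsilon> ^ 3)"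
        unfolding B_def using \<epsilon> x exp_ge_add_one_self[of x]
        by (intro mult_left_mono le_fourth_power) linarith+
      finally show ?thesis using 3 y \<epsilon> AB' by (simp add: max_def min_def)
    qed
  qed
  moreover have "G z = G y + exp (- y) * (exp (- x) - 1) + (1 + \<epsilon>) * x"
    unfolding G_def z_def dynkin_add by (simp add: algebra_simps)
  ultimately show ?thesis
    unfolding A_def[symmetric] B_def[symmetric] z_def[symmetric]
    by (simp add: algebra_simps add_divide_distrib)
qed

lemma fourth_power_expansion:
  fixes x :: real
  shows "(exp x - 1) ^ 4 = exp (4 * x) - 4 * exp (3 * x) + 6 * exp (2 * x) - 4 * exp x + 1"
proof -
  have "(e - 1) ^ 4 = e ^ 4 - 4 * e ^ 3 + 6 * e ^ 2 - 4 * e + 1" for e :: real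
    by algebra
  moreover have "exp (real n * x) = exp x ^ n" for n by (rule exp_of_nat_mult)
  from this[of 2] this[of 3] this[of 4]
  have "exp (2 * x) = exp x ^ 2" "exp (3 * x) = exp x ^ 3" "exp (4 * x) = exp x ^ 4"
    by simp_all
  ultimately show ?thesis by metis
qed

section \<open>Expected passage times of Gaussian walks\<close>

lemma normal_density_mgf:
  assumes "0 < \<sigma>"
  shows "normal_density m \<sigma> x * exp (\<theta> * x)
      = exp (\<theta> * m + \<theta>\<^sup>2 * \<sigma>\<^sup>2 / 2) * normal_density (m + \<theta> * \<sigma>\<^sup>2) \<sigma> x"
proof -
  have "- (x - m)\<^sup>2 / (2 * \<sigma>\<^sup>2) + \<theta> * x
      = (\<theta> * m + \<theta>\<^sup>2 * \<sigma>\<^sup>2 / 2) + - (x - (m + \<theta> * \<sigma>\<^sup>2))\<^sup>2 / (2 * \<sigma>\<^sup>2)"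
    using assms by (simp add: field_simps power2_eq_square)
  then show ?thesis unfolding normal_density_def by (simp flip: exp_add)
qed

lemma (in prob_space) normal_mgf:
  assumes X: "distributed M lborel X (normal_density m \<sigma>)" and "0 < \<sigma>"
  shows "integrable M (\<lambda>\<omega>. exp (\<theta> * X \<omega>))"
    and "expectation (\<lambda>\<omega>. exp (\<theta> * X \<omega>)) = exp (\<theta> * m + \<theta>\<^sup>2 * \<sigma>\<^sup>2 / 2)"
proof -
  show "integrable M (\<lambda>\<omega>. exp (\<theta> * X \<omega>))"
    using assms(2) by (subst distributed_integrable[OF X, symmetric]) (auto simp: normal_density_mgf)
  show "expectation (\<lambda>\<omega>. exp (\<theta> * X \<omega>)) = exp (\<theta> * m + \<theta>\<^sup>2 * \<sigma>\<^sup>2 / 2)"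
    using assms(2) by (subst distributed_integral[OF X, symmetric]) (auto simp: normal_density_mgf)
qed

text \<open>The expectation of \<open>(exp (- \<xi>) - 1) ^ 4 + (exp \<xi> - 1) ^ 4\<close> for \<open>\<xi>\<close> normal with mean \<open>c\<close> and
  variance \<open>2c\<close>.\<close>

definition fourth_moment :: "real \<Rightarrow> real" where
  "fourth_moment c = - 2 + 2 * exp (2 * c) + 2 * exp (6 * c) - 3 * exp (12 * c) + exp (20 * c)"

text \<open>The first-order coefficient at \<open>0\<close> vanishes: \<open>4 + 12 - 36 + 20 = 0\<close>.\<close>

lemma fourth_moment_small:
  assumes "0 < \<delta>"
  shows "\<forall>\<^sub>F c in at_right 0. fourth_moment c \<le> \<delta> * c"
proof -
  have "(fourth_moment has_real_derivative 0) (at 0)"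
    unfolding fourth_moment_def[abs_def] by (auto intro!: derivative_eq_intros)
  moreover have "fourth_moment 0 = 0" by (simp add: fourth_moment_def)
  ultimately have "((\<lambda>c. fourth_moment c / c) \<longlongrightarrow> 0) (at 0)"
    by (simp add: has_field_derivative_iff)
  then have "((\<lambda>c. fourth_moment c / c) \<longlongrightarrow> 0) (at_right 0)"
    by (rule tendsto_mono[rotated]) (simp add: at_within_le_at)
  then have "\<forall>\<^sub>F c in at_right 0. fourth_moment c / c < \<delta>"
    by (rule order_tendstoD) fact
  moreover have "\<forall>\<^sub>F c :: real in at_right 0. 0 < c" by (rule eventually_at_right_less)
  ultimately show ?thesis by eventually_elim (simp add: field_simps)
qed

text \<open>The increments over steps of length \<open>h\<close> of Brownian motion with drift \<open>b\<close> and variance \<open>2a\<close> per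
  unit time. In this parametrisation \<open>E[exp (- \<xi>)] = exp ((a - b) h)\<close>, so \<open>a = b\<close> is the case in
  which \<open>exp (- S)\<close> is a martingale for the unreflected walk \<open>S\<close>.\<close>

locale gaussian_walk = prob_space M for M :: "'a measure" +
  fixes \<xi> :: "nat \<Rightarrow> 'a \<Rightarrow> real" and a b h :: real
  assumes indep: "\<And>k. indep_vars (\<lambda>_. borel) \<xi> {..<k}"
    and dist: "\<And>k. distributed M lborel (\<xi> k) (normal_density (b * h) (sqrt (2 * a * h)))"
    and a: "0 < a" and h: "0 < h"
begin

abbreviation walk :: "real \<Rightarrow> nat \<Rightarrow> 'a \<Rightarrow> real" where
  "walk \<nu> k \<omega> \<equiv> stopped_walk \<nu> (\<lambda>i. \<xi> i \<omega>) k"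

definition survival :: "real \<Rightarrow> nat \<Rightarrow> real" where
  "survival \<nu> k = expectation (\<lambda>\<omega>. indicator {..<\<nu>} (walk \<nu> k \<omega>))"

lemma measurable_increment [measurable]: "\<xi> k \<in> borel_measurable M"
  using distributed_measurable[OF dist] by simp

lemma measurable_walk [measurable]: "walk \<nu> k \<in> borel_measurable M"
  by (induction k) (simp_all add: Let_def)

lemma exp_increment:
  "integrable M (\<lambda>\<omega>. exp (\<theta> * \<xi> k \<omega>))"
  "expectation (\<lambda>\<omega>. exp (\<theta> * \<xi> k \<omega>)) = exp (\<theta> * b * h + \<theta>\<^sup>2 * a * h)"
  using normal_mgf[OF dist, of \<theta> k] a h by (auto simp: algebra_simps)

lemma mean_increment:
  "integrable M (\<xi> k)" "expectation (\<xi> k) = b * h"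
  using normal_distributed_expectation[OF _ dist, of k]
    distributed_integrable[OF dist, of "\<lambda>x. x" k] integrable_normal_moment_nz_1 a h
  by (auto)

text \<open>The walk at step \<open>k\<close> depends only on the increments before \<open>k\<close>.\<close>

lemma walk_indep_increment: "indep_var borel (walk \<nu> k) borel (\<xi> k)"
proof -
  have walk_restrict: "stopped_walk \<nu> (restrict x {..<k}) j = stopped_walk \<nu> x j" if "j \<le> k" for x j
    using that by (induction j) (simp_all add: Let_def)
  have meas: "(\<lambda>x. stopped_walk \<nu> x j) \<in> borel_measurable (PiM {..<k} (\<lambda>_. borel))" if "j \<le> k" for j
    using that
  proof (induction j)
    case (Suc j)
    then have [measurable]: "(\<lambda>x. x j) \<in> borel_measurable (PiM {..<k} (\<lambda>_. borel :: real measure))"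
      by (intro measurable_component_singleton) auto
    have [measurable]: "(\<lambda>x. stopped_walk \<nu> x j) \<in> borel_measurable (PiM {..<k} (\<lambda>_. borel))"
      using Suc by simp
    show ?case by (simp add: Let_def)
  qed simp
  have "indep_var borel ((\<lambda>x. stopped_walk \<nu> x k) \<circ> (\<lambda>\<omega>. restrict (\<lambda>i. \<xi> i \<omega>) {..<k}))
      borel ((\<lambda>x. x k) \<circ> (\<lambda>\<omega>. restrict (\<lambda>i. \<xi> i \<omega>) {k}))"
    by (rule indep_var_compose[OF indep_var_restrict[OF indep[of "Suc k"]]])
      (auto intro: meas measurable_component_singleton)
  then show ?thesis by (simp add: o_def walk_restrict)
qed

lemma expectation_walk_times_increment:
  fixes g p :: "real \<Rightarrow> real"
  assumes [measurable]: "g \<in> borel_measurable borel" "p \<in> borel_measurable borel"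
    and bounded: "\<And>y. 0 \<le> y \<Longrightarrow> \<bar>g y\<bar> \<le> 1"
    and p: "integrable M (\<lambda>\<omega>. p (\<xi> k \<omega>))"
  shows "integrable M (\<lambda>\<omega>. g (walk \<nu> k \<omega>) * p (\<xi> k \<omega>))"
    and "expectation (\<lambda>\<omega>. g (walk \<nu> k \<omega>) * p (\<xi> k \<omega>))
      = expectation (\<lambda>\<omega>. g (walk \<nu> k \<omega>)) * expectation (\<lambda>\<omega>. p (\<xi> k \<omega>))"
proof -
  have "indep_var borel (g \<circ> walk \<nu> k) borel (p \<circ> \<xi> k)"
    by (rule indep_var_compose[OF walk_indep_increment]) auto
  then have ind: "indep_var borel (\<lambda>\<omega>. g (walk \<nu> k \<omega>)) borel (\<lambda>\<omega>. p (\<xi> k \<omega>))"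
    by (simp add: o_def)
  have g: "integrable M (\<lambda>\<omega>. g (walk \<nu> k \<omega>))"
    by (rule integrable_const_bound[of _ 1]) (auto intro!: bounded stopped_walk_nonneg)
  show "integrable M (\<lambda>\<omega>. g (walk \<nu> k \<omega>) * p (\<xi> k \<omega>))"
    by (rule indep_var_integrable[OF ind g p])
  show "expectation (\<lambda>\<omega>. g (walk \<nu> k \<omega>) * p (\<xi> k \<omega>))
      = expectation (\<lambda>\<omega>. g (walk \<nu> k \<omega>)) * expectation (\<lambda>\<omega>. p (\<xi> k \<omega>))"
    by (rule indep_var_lebesgue_integral[OF ind g p])
qed

lemma survival_bounds: "0 \<le> survival \<nu> k" "survival \<nu> k \<le> 1"
proof -
  show "0 \<le> survival \<nu> k" unfolding survival_def by simp
  have "survival \<nu> k \<le> expectation (\<lambda>_. 1)"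
    unfolding survival_def
    by (intro integral_mono integrable_const_bound[of _ 1]) (auto simp: indicator_def)
  then show "survival \<nu> k \<le> 1" by (simp add: prob_space)
qed

lemma expected_walk_time:
  "(\<integral>\<^sup>+\<omega>. (\<Sum>k. ennreal h * indicator {..<\<nu>} (walk \<nu> k \<omega>)) \<partial>M)
    = (\<Sum>k. ennreal (h * survival \<nu> k))"
proof -
  have "(\<integral>\<^sup>+\<omega>. ennreal h * indicator {..<\<nu>} (walk \<nu> k \<omega>) \<partial>M) = ennreal (h * survival \<nu> k)" for k
  proof -
    have "(\<integral>\<^sup>+\<omega>. ennreal h * indicator {..<\<nu>} (walk \<nu> k \<omega>) \<partial>M)
        = (\<integral>\<^sup>+\<omega>. ennreal (h * indicator {..<\<nu>} (walk \<nu> k \<omega>)) \<partial>M)"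
      using h by (intro nn_integral_cong) (simp add: indicator_def)
    also have "\<dots> = ennreal (expectation (\<lambda>\<omega>. h * indicator {..<\<nu>} (walk \<nu> k \<omega>)))"
      using h by (intro nn_integral_eq_integral integrable_const_bound[of _ h])
        (auto simp: indicator_def)
    finally show ?thesis by (simp add: survival_def)
  qed
  then show ?thesis by (subst nn_integral_suminf) auto
qed

text \<open>Each step taken below \<open>\<nu>\<close> adds at most \<open>b h\<close> in expectation: the linear part contributes \<open>b h\<close>,
  and the exponential part is nonpositive since \<open>E[exp (- \<xi>)] \<le> 1\<close> for \<open>a \<le> b\<close>.\<close>

lemma dynkin_expectation_le:
  assumes \<nu>: "0 < \<nu>" and ab: "a \<le> b"
  shows "expectation (\<lambda>\<omega>. dynkin (min (walk \<nu> n \<omega>) \<nu>)) \<le> b * h * (\<Sum>k<n. survival \<nu> k)"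
proof (induction n)
  case 0
  then show ?case using \<nu> by simp
next
  case (Suc n)
  let ?I = "\<lambda>\<omega>. indicator {..<\<nu>} (walk \<nu> n \<omega>) :: real"
  let ?E = "\<lambda>\<omega>. ?I \<omega> * exp (- walk \<nu> n \<omega>)"
  let ?\<phi> = "\<lambda>n \<omega>. dynkin (min (walk \<nu> n \<omega>) \<nu>)"
  have int: "integrable M (?\<phi> n)" for n
    using \<nu> stopped_walk_nonneg[of \<nu>]
    by (intro integrable_const_bound[of _ "dynkin \<nu>"])
       (auto simp: dynkin_nonneg intro!: dynkin_mono)
  have exp_int: "integrable M (\<lambda>\<omega>. exp (- \<xi> n \<omega>) - 1)"
    and exp_mean: "expectation (\<lambda>\<omega>. exp (- \<xi> n \<omega>) - 1) \<le> 0"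
    using exp_increment[of "-1" n] ab h by (auto simp: prob_space)
  note 1 = expectation_walk_times_increment[of "\<lambda>y. indicator {..<\<nu>} y * exp (- y)" "\<lambda>x. exp (- x) - 1" n \<nu>]
  note 2 = expectation_walk_times_increment[of "\<lambda>y. indicator {..<\<nu>} y" "\<lambda>x. x" n \<nu>]
  have 1: "integrable M (\<lambda>\<omega>. ?E \<omega> * (exp (- \<xi> n \<omega>) - 1))"
      "expectation (\<lambda>\<omega>. ?E \<omega> * (exp (- \<xi> n \<omega>) - 1)) = expectation ?E * expectation (\<lambda>\<omega>. exp (- \<xi> n \<omega>) - 1)"
    by (intro 1; auto simp: indicator_def exp_int)+
  have 2: "integrable M (\<lambda>\<omega>. ?I \<omega> * \<xi> n \<omega>)"
      "expectation (\<lambda>\<omega>. ?I \<omega> * \<xi> n \<omega>) = survival \<nu> n * (b * h)"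
    unfolding survival_def mean_increment(2)[of n, symmetric]
    by (intro 2; auto simp: indicator_def mean_increment)+
  have "expectation (?\<phi> (Suc n))
      \<le> expectation (\<lambda>\<omega>. ?\<phi> n \<omega> + ?E \<omega> * (exp (- \<xi> n \<omega>) - 1) + ?I \<omega> * \<xi> n \<omega>)"
    using dynkin_step_le[OF \<nu>] 
    by (intro integral_mono int Bochner_Integration.integrable_add 1 2) (simp add: Let_def)
  also have "\<dots> = expectation (?\<phi> n) + expectation ?E * expectation (\<lambda>\<omega>. exp (- \<xi> n \<omega>) - 1)
      + survival \<nu> n * (b * h)"
    by (simp only: Bochner_Integration.integral_add int 1 2 Bochner_Integration.integrable_add)
  also have "\<dots> \<le> expectation (?\<phi> n) + survival \<nu> n * (b * h)"
    using exp_mean by (simp add: mult_nonneg_nonpos)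
  also have "\<dots> \<le> b * h * (\<Sum>k<Suc n. survival \<nu> k)"
    using Suc by (simp add: algebra_simps)
  finally show ?case .
qed

text \<open>If the expected passage time is finite then almost surely the walk is eventually frozen at or above \<open>\<nu>\<close>, where
  the truncated function equals \<open>dynkin \<nu>\<close>; comparing with the expected gain per step gives the
  bound.\<close>

lemma expected_walk_time_ge:
  assumes \<nu>: "0 < \<nu>" and ab: "a \<le> b"
  shows "ennreal (dynkin \<nu> / b) \<le> (\<Sum>k. ennreal (h * survival \<nu> k))"
proof (cases "(\<Sum>k. ennreal (h * survival \<nu> k)) = \<top>")
  case False
  then have sum: "summable (\<lambda>k. h * survival \<nu> k)"
    using h survival_bounds by (intro summable_suminf_not_top) auto
  let ?s = "suminf (\<lambda>k. h * survival \<nu> k)"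
  have "(\<lambda>k. h * survival \<nu> k) \<longlonglongrightarrow> 0" by (rule summable_LIMSEQ_zero[OF sum])
  from tendsto_divide[OF this tendsto_const[of h]] have lim: "survival \<nu> \<longlonglongrightarrow> 0" using h by simp
  have "dynkin \<nu> * (1 - survival \<nu> n) \<le> b * ?s" for n
  proof -
    have "dynkin \<nu> * (1 - survival \<nu> n)
        = expectation (\<lambda>\<omega>. dynkin \<nu> * (1 - indicator {..<\<nu>} (walk \<nu> n \<omega>)))"
      unfolding survival_def
      by (subst integral_mult_right_zero, subst Bochner_Integration.integral_diff)
         (auto intro!: integrable_const_bound[of _ 1] simp: prob_space indicator_def)
    also have "\<dots> \<le> expectation (\<lambda>\<omega>. dynkin (min (walk \<nu> n \<omega>) \<nu>))"
    proof (rule integral_mono)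
      show "integrable M (\<lambda>\<omega>. dynkin \<nu> * (1 - indicator {..<\<nu>} (walk \<nu> n \<omega>)))"
        by (rule integrable_const_bound[of _ "dynkin \<nu>"]) (auto simp: indicator_def dynkin_nonneg)
      show "integrable M (\<lambda>\<omega>. dynkin (min (walk \<nu> n \<omega>) \<nu>))"
        using \<nu> stopped_walk_nonneg[of \<nu>]
        by (intro integrable_const_bound[of _ "dynkin \<nu>"])
          (auto simp: dynkin_nonneg intro!: dynkin_mono)
    qed (auto simp: indicator_def min_def dynkin_nonneg)
    also have "\<dots> \<le> b * (\<Sum>k<n. h * survival \<nu> k)"
      using dynkin_expectation_le[OF \<nu> ab, of n] by (simp add: sum_distrib_left algebra_simps)
    also have "\<dots> \<le> b * ?s"
      using a ab h survival_bounds by (intro mult_left_mono sum_le_suminf sum) auto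
    finally show ?thesis .
  qed
  moreover have "(\<lambda>n. dynkin \<nu> * (1 - survival \<nu> n)) \<longlonglongrightarrow> dynkin \<nu> * (1 - 0)"
    by (intro tendsto_intros lim)
  ultimately have "dynkin \<nu> \<le> b * ?s"
    by (intro tendsto_upperbound[of _ "dynkin \<nu>" sequentially]) auto
  then have "dynkin \<nu> / b \<le> ?s" using a ab by (simp add: field_simps)
  then show ?thesis
    using sum h survival_bounds by (subst suminf_ennreal2) (auto intro!: ennreal_leI)
qed simp

lemma expectation_fourth_moment:
  assumes "b = a"
  shows "integrable M (\<lambda>\<omega>. (exp (- \<xi> k \<omega>) - 1) ^ 4 + (exp (\<xi> k \<omega>) - 1) ^ 4)"
    and "expectation (\<lambda>\<omega>. (exp (- \<xi> k \<omega>) - 1) ^ 4 + (exp (\<xi> k \<omega>) - 1) ^ 4) = fourth_moment (a * h)"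
proof -
  have "integrable M (\<lambda>\<omega>. exp (- (4 * \<xi> k \<omega>)))" "integrable M (\<lambda>\<omega>. exp (- (3 * \<xi> k \<omega>)))"
    "integrable M (\<lambda>\<omega>. exp (- (2 * \<xi> k \<omega>)))" "integrable M (\<lambda>\<omega>. exp (- \<xi> k \<omega>))"
    "integrable M (\<lambda>\<omega>. exp (4 * \<xi> k \<omega>))" "integrable M (\<lambda>\<omega>. exp (3 * \<xi> k \<omega>))"
    "integrable M (\<lambda>\<omega>. exp (2 * \<xi> k \<omega>))" "integrable M (\<lambda>\<omega>. exp (\<xi> k \<omega>))"
    using exp_increment(1)[of "-4" k] exp_increment(1)[of "-3" k] exp_increment(1)[of "-2" k]
      exp_increment(1)[of "-1" k] exp_increment(1)[of 4 k] exp_increment(1)[of 3 k]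
      exp_increment(1)[of 2 k] exp_increment(1)[of 1 k] by simp_all
  moreover have "expectation (\<lambda>\<omega>. exp (- (4 * \<xi> k \<omega>))) = exp (12 * a * h)"
    "expectation (\<lambda>\<omega>. exp (- (3 * \<xi> k \<omega>))) = exp (6 * a * h)"
    "expectation (\<lambda>\<omega>. exp (- (2 * \<xi> k \<omega>))) = exp (2 * a * h)"
    "expectation (\<lambda>\<omega>. exp (- \<xi> k \<omega>)) = 1"
    "expectation (\<lambda>\<omega>. exp (4 * \<xi> k \<omega>)) = exp (20 * a * h)"
    "expectation (\<lambda>\<omega>. exp (3 * \<xi> k \<omega>)) = exp (12 * a * h)"
    "expectation (\<lambda>\<omega>. exp (2 * \<xi> k \<omega>)) = exp (6 * a * h)"
    "expectation (\<lambda>\<omega>. exp (\<xi> k \<omega>)) = exp (2 * a * h)"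
    using exp_increment(2)[of "-4" k] exp_increment(2)[of "-3" k] exp_increment(2)[of "-2" k]
      exp_increment(2)[of "-1" k] exp_increment(2)[of 4 k] exp_increment(2)[of 3 k]
      exp_increment(2)[of 2 k] exp_increment(2)[of 1 k] assms by simp_all
  ultimately show "integrable M (\<lambda>\<omega>. (exp (- \<xi> k \<omega>) - 1) ^ 4 + (exp (\<xi> k \<omega>) - 1) ^ 4)"
    "expectation (\<lambda>\<omega>. (exp (- \<xi> k \<omega>) - 1) ^ 4 + (exp (\<xi> k \<omega>) - 1) ^ 4) = fourth_moment (a * h)"
    unfolding fourth_power_expansion fourth_moment_def by (simp_all add: prob_space mult.assoc)
qed

text \<open>For \<open>a = b\<close> the exponential part has mean zero exactly, and the tilted linear part contributes
  \<open>(1 + \<epsilon>) a h\<close>, whose excess over \<open>a h\<close> covers the fourth moments for small steps.\<close>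

lemma dynkin_tilted_expectation_ge:
  assumes \<nu>: "0 < \<nu>" and ba: "b = a" and \<epsilon>: "0 < \<epsilon>" "\<epsilon> \<le> 1"
    and small: "2 / \<epsilon> ^ 3 * fourth_moment (a * h) \<le> \<epsilon> * a * h"
  shows "a * h * (\<Sum>k<n. survival \<nu> k)
    \<le> expectation (\<lambda>\<omega>. dynkin (min (walk \<nu> n \<omega>) (\<nu> + \<epsilon>)) + \<epsilon> * min (walk \<nu> n \<omega>) (\<nu> + \<epsilon>))"
    (is "_ \<le> expectation (?\<phi> n)")
proof (induction n)
  case 0
  then show ?case using \<nu> \<epsilon> by simp
next
  case (Suc n)
  let ?I = "\<lambda>\<omega>. indicator {..<\<nu>} (walk \<nu> n \<omega>) :: real"
  let ?E = "\<lambda>\<omega>. ?I \<omega> * exp (- walk \<nu> n \<omega>)"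
  let ?q = "\<lambda>x. (1 + \<epsilon>) * x - 2 / \<epsilon> ^ 3 * ((exp (- x) - 1) ^ 4 + (exp x - 1) ^ 4)"
  have int: "integrable M (?\<phi> n)" for n
  proof (rule integrable_const_bound[of _ "dynkin (\<nu> + \<epsilon>) + \<epsilon> * (\<nu> + \<epsilon>)"])
    show "AE \<omega> in M. norm (?\<phi> n \<omega>) \<le> dynkin (\<nu> + \<epsilon>) + \<epsilon> * (\<nu> + \<epsilon>)"
      using \<nu> \<epsilon> stopped_walk_nonneg[of \<nu>]
      by (auto simp: dynkin_nonneg intro!: dynkin_tilted_mono)
  qed (simp add: dynkin_def)
  have exp_int: "integrable M (\<lambda>\<omega>. exp (- \<xi> n \<omega>) - 1)"
    and exp_mean: "expectation (\<lambda>\<omega>. exp (- \<xi> n \<omega>) - 1) = 0"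
    using exp_increment[of "-1" n] ba by (auto simp: prob_space)
  have q_int: "integrable M (\<lambda>\<omega>. ?q (\<xi> n \<omega>))"
    by (intro Bochner_Integration.integrable_diff integrable_mult_right mean_increment expectation_fourth_moment ba)
  have q_mean: "a * h \<le> expectation (\<lambda>\<omega>. ?q (\<xi> n \<omega>))"
  proof -
    have "expectation (\<lambda>\<omega>. ?q (\<xi> n \<omega>)) = (1 + \<epsilon>) * (b * h) - 2 / \<epsilon> ^ 3 * fourth_moment (a * h)"
      by (subst Bochner_Integration.integral_diff)
         (auto intro!: mean_increment expectation_fourth_moment ba simp del: times_divide_eq_left
           simp: mean_increment(2) expectation_fourth_moment(2)[OF ba])
    then show ?thesis using small ba by (simp add: algebra_simps)
  qed
  note 1 = expectation_walk_times_increment[of "\<lambda>y. indicator {..<\<nu>} y * exp (- y)" "\<lambda>x. exp (- x) - 1" n \<nu>]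
  note 2 = expectation_walk_times_increment[of "\<lambda>y. indicator {..<\<nu>} y" ?q n \<nu>]
  have 1: "integrable M (\<lambda>\<omega>. ?E \<omega> * (exp (- \<xi> n \<omega>) - 1))"
      "expectation (\<lambda>\<omega>. ?E \<omega> * (exp (- \<xi> n \<omega>) - 1)) = expectation ?E * expectation (\<lambda>\<omega>. exp (- \<xi> n \<omega>) - 1)"
    by (intro 1; auto simp: indicator_def exp_int)+
  have 2: "integrable M (\<lambda>\<omega>. ?I \<omega> * ?q (\<xi> n \<omega>))"
      "expectation (\<lambda>\<omega>. ?I \<omega> * ?q (\<xi> n \<omega>)) = survival \<nu> n * expectation (\<lambda>\<omega>. ?q (\<xi> n \<omega>))"
    unfolding survival_def by (intro 2 q_int; simp add: indicator_def)+
  have "a * h * (\<Sum>k<Suc n. survival \<nu> k) \<le> expectation (?\<phi> n) + survival \<nu> n * (a * h)"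
    using Suc by (simp add: algebra_simps)
  also have "\<dots> \<le> expectation (?\<phi> n) + survival \<nu> n * expectation (\<lambda>\<omega>. ?q (\<xi> n \<omega>))"
    by (intro add_left_mono mult_left_mono q_mean survival_bounds)
  also have "\<dots> = expectation (\<lambda>\<omega>. ?\<phi> n \<omega> + ?E \<omega> * (exp (- \<xi> n \<omega>) - 1) + ?I \<omega> * ?q (\<xi> n \<omega>))"
    by (simp only: Bochner_Integration.integral_add int 1 2 Bochner_Integration.integrable_add exp_mean
        mult_zero_right add_0_right)
  also have "\<dots> \<le> expectation (?\<phi> (Suc n))"
  proof (intro integral_mono int Bochner_Integration.integrable_add 1 2)
    fix \<omega>
    show "?\<phi> n \<omega> + ?E \<omega> * (exp (- \<xi> n \<omega>) - 1) + ?I \<omega> * ?q (\<xi> n \<omega>) \<le> ?\<phi> (Suc n) \<omega>"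
    proof (cases "walk \<nu> n \<omega> < \<nu>")
      case True
      then have "min (walk \<nu> n \<omega>) (\<nu> + \<epsilon>) = walk \<nu> n \<omega>" using \<epsilon> by simp
      then show ?thesis
        using True dynkin_tilted_step_ge[OF \<epsilon> stopped_walk_nonneg True, of "\<xi> n \<omega>"]
        by (simp add: Let_def algebra_simps)
    qed (simp add: Let_def)
  qed
  finally show ?case .
qed

lemma expected_walk_time_le:
  assumes \<nu>: "0 < \<nu>" and ba: "b = a" and \<epsilon>: "0 < \<epsilon>" "\<epsilon> \<le> 1"
    and small: "2 / \<epsilon> ^ 3 * fourth_moment (a * h) \<le> \<epsilon> * a * h"
  shows "(\<Sum>k. ennreal (h * survival \<nu> k)) \<le> ennreal ((dynkin (\<nu> + \<epsilon>) + \<epsilon> * (\<nu> + \<epsilon>)) / a)"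
proof -
  have "(\<Sum>k<n. ennreal (h * survival \<nu> k)) \<le> ennreal ((dynkin (\<nu> + \<epsilon>) + \<epsilon> * (\<nu> + \<epsilon>)) / a)" for n
  proof -
    let ?\<phi> = "\<lambda>\<omega>. dynkin (min (walk \<nu> n \<omega>) (\<nu> + \<epsilon>)) + \<epsilon> * min (walk \<nu> n \<omega>) (\<nu> + \<epsilon>)"
    have "a * h * (\<Sum>k<n. survival \<nu> k) \<le> expectation ?\<phi>"
      by (rule dynkin_tilted_expectation_ge[OF assms])
    also have "\<dots> \<le> expectation (\<lambda>_. dynkin (\<nu> + \<epsilon>) + \<epsilon> * (\<nu> + \<epsilon>))"
      using \<nu> \<epsilon> stopped_walk_nonneg[of \<nu>]
      by (intro integral_mono') (auto simp: dynkin_nonneg intro!: dynkin_tilted_mono)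
    finally have "(\<Sum>k<n. h * survival \<nu> k) \<le> (dynkin (\<nu> + \<epsilon>) + \<epsilon> * (\<nu> + \<epsilon>)) / a"
      using a by (simp add: prob_space sum_distrib_left field_simps)
    then show ?thesis
      using h survival_bounds by (subst sum_ennreal) (auto intro!: ennreal_leI)
  qed
  then show ?thesis by (intro suminf_le_const summableI)
qed

end

section \<open>Expected draw-up times of Brownian motion with drift\<close>

text \<open>Specified through the increments along equidistant grids, so that every sampling of the path
  yields a Gaussian walk to which Lindley's recursion applies.\<close>

locale drifted_brownian = prob_space M for M :: "'a measure" +
  fixes X :: "real \<Rightarrow> 'a \<Rightarrow> real" and a b :: real
  assumes increments: "\<And>h. 0 < h \<Longrightarrow>
      gaussian_walk M (\<lambda>k \<omega>. X (real (Suc k) * h) \<omega> - X (real k * h) \<omega>) a b h"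
    and measurable_X: "\<And>t. 0 \<le> t \<Longrightarrow> X t \<in> borel_measurable M"
    and continuous_X: "\<And>\<omega>. \<omega> \<in> space M \<Longrightarrow> continuous_on {0..} (\<lambda>t. X t \<omega>)"
begin

lemma variance_pos: "0 < a"
  using gaussian_walk.a[OF increments[of 1]] by simp

lemma expected_grid_time_ge:
  assumes "0 < h" "0 < \<nu>" "a \<le> b"
  shows "ennreal (dynkin \<nu> / b) \<le> (\<integral>\<^sup>+\<omega>. drawup_time (grid h) (\<lambda>t. X t \<omega>) \<nu> \<partial>M)"
proof -
  interpret gaussian_walk M "\<lambda>k \<omega>. X (real (Suc k) * h) \<omega> - X (real k * h) \<omega>" a b h
    by (rule increments[OF assms(1)])
  show ?thesis
    unfolding drawup_time_grid_eq_suminf[OF assms(1)] expected_walk_time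
    by (rule expected_walk_time_ge[OF assms(2,3)])
qed

lemma expected_grid_time_le:
  assumes "0 < \<nu>" "b = a" "0 < \<epsilon>" "\<epsilon> \<le> 1"
  shows "\<forall>\<^sub>F h in at_right 0. (\<integral>\<^sup>+\<omega>. drawup_time (grid h) (\<lambda>t. X t \<omega>) \<nu> \<partial>M)
    \<le> ennreal ((dynkin (\<nu> + \<epsilon>) + \<epsilon> * (\<nu> + \<epsilon>)) / a)"
proof -
  have "((\<lambda>h. a * h) \<longlongrightarrow> a * 0) (at_right 0)" by (intro tendsto_intros)
  moreover have "\<forall>\<^sub>F h :: real in at_right 0. 0 < h" by (rule eventually_at_right_less)
  ultimately have "filterlim (\<lambda>h. a * h) (at_right 0) (at_right 0)"
    using variance_pos by (auto simp: filterlim_at elim: eventually_mono)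
  moreover have "\<forall>\<^sub>F c in at_right 0. fourth_moment c \<le> (\<epsilon> ^ 4 / 2) * c"
    using assms by (intro fourth_moment_small) auto
  ultimately have "\<forall>\<^sub>F h in at_right 0. fourth_moment (a * h) \<le> (\<epsilon> ^ 4 / 2) * (a * h)"
    by (rule eventually_compose_filterlim[rotated])
  then show ?thesis using \<open>\<forall>\<^sub>F h :: real in at_right 0. 0 < h\<close>
  proof eventually_elim
    case (elim h)
    interpret gaussian_walk M "\<lambda>k \<omega>. X (real (Suc k) * h) \<omega> - X (real k * h) \<omega>" a b h
      by (rule increments[OF elim(2)])
    \<comment> \<open>The coefficient \<open>\<epsilon> ^ 4 / 2\<close> above makes the error \<open>\<epsilon> * a * h\<close>, the surplus drift of the tilt.\<close>
    have "2 / \<epsilon> ^ 3 * fourth_moment (a * h) \<le> 2 / \<epsilon> ^ 3 * ((\<epsilon> ^ 4 / 2) * (a * h))"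
      using elim(1) assms by (intro mult_left_mono) auto
    also have "\<dots> = \<epsilon> * a * h" using assms power_Suc[of \<epsilon> 3] by (simp add: field_simps)
    finally show ?case
      unfolding drawup_time_grid_eq_suminf[OF elim(2)] expected_walk_time
      by (intro expected_walk_time_le assms)
  qed
qed

text \<open>The bound for grids passes to continuous time at a slightly lower level \<open>\<nu>'\<close>: the grid times
  decrease under refinement to a limit below the draw-up time of \<open>\<nu>\<close>. Monotone convergence from
  above requires one finite expectation, which is a hypothesis here because the upper
  bounds are available for the drift \<open>a\<close> only; larger drifts inherit finiteness by comparison.\<close>

lemma expected_drawup_time_ge:
  assumes \<nu>: "0 < \<nu>" and ab: "a \<le> b"
    and finite: "\<And>\<nu>. 0 < \<nu> \<Longrightarrow>
      \<exists>j. (\<integral>\<^sup>+\<omega>. drawup_time (grid ((1/2) ^ j)) (\<lambda>t. X t \<omega>) \<nu> \<partial>M) < \<top>"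
  shows "ennreal (dynkin \<nu> / b) \<le> (\<integral>\<^sup>+\<omega>. drawup_time {0..} (\<lambda>t. X t \<omega>) \<nu> \<partial>M)"
proof -
  have below: "ennreal (dynkin \<nu>' / b) \<le> (\<integral>\<^sup>+\<omega>. drawup_time {0..} (\<lambda>t. X t \<omega>) \<nu> \<partial>M)"
    if \<nu>': "0 < \<nu>'" "\<nu>' < \<nu>" for \<nu>'
  proof -
    let ?T = "\<lambda>j \<omega>. drawup_time (grid ((1/2) ^ j)) (\<lambda>t. X t \<omega>) \<nu>'"
    obtain i where i: "(\<integral>\<^sup>+\<omega>. ?T i \<omega> \<partial>M) < \<infinity>"
      using finite[OF \<nu>'(1)] by auto
    have "ennreal (dynkin \<nu>' / b) \<le> (INF j. \<integral>\<^sup>+\<omega>. ?T j \<omega> \<partial>M)"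
      by (intro INF_greatest expected_grid_time_ge \<nu>' ab) simp
    also have "\<dots> = (\<integral>\<^sup>+\<omega>. (INF j. ?T j \<omega>) \<partial>M)"
    proof (rule nn_integral_monotone_convergence_INF_decseq[where f = ?T and i = i, symmetric])
      show "decseq ?T"
        by (intro decseq_SucI le_funI drawup_time_mono grid_refine) auto
      show "?T j \<in> borel_measurable M" for j
        by (intro measurable_drawup_time_grid measurable_X) auto
    qed (rule i)
    also have "\<dots> \<le> (\<integral>\<^sup>+\<omega>. drawup_time {0..} (\<lambda>t. X t \<omega>) \<nu> \<partial>M)"
      by (intro nn_integral_mono drawup_time_dyadic continuous_X \<nu>')
    finally show ?thesis .
  qed
  have "((\<lambda>y. ennreal (dynkin y / b)) \<longlongrightarrow> ennreal (dynkin \<nu> / b)) (at_left \<nu>)"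
    unfolding dynkin_def by (intro tendsto_intros tendsto_ennrealI) (use variance_pos ab in auto)
  moreover have "\<forall>\<^sub>F y in at_left \<nu>. 0 < y \<and> y < \<nu>"
    using eventually_at_left_real[OF \<nu>] by eventually_elim auto
  then have "\<forall>\<^sub>F y in at_left \<nu>.
      ennreal (dynkin y / b) \<le> (\<integral>\<^sup>+\<omega>. drawup_time {0..} (\<lambda>t. X t \<omega>) \<nu> \<partial>M)"
    by eventually_elim (auto intro: below)
  ultimately show ?thesis by (rule tendsto_upperbound) simp
qed

lemma grid_time_finite:
  assumes "b = a" "0 < \<nu>"
  shows "\<exists>j. (\<integral>\<^sup>+\<omega>. drawup_time (grid ((1/2) ^ j)) (\<lambda>t. X t \<omega>) \<nu> \<partial>M) < \<top>"
proof -
  have "filterlim (\<lambda>j. (1/2::real) ^ j) (at_right 0) sequentially"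
    by (auto simp: filterlim_at intro!: LIMSEQ_power_zero)
  from eventually_compose_filterlim[OF expected_grid_time_le[OF assms(2,1), of 1] this]
  have "\<forall>\<^sub>F j in sequentially. (\<integral>\<^sup>+\<omega>. drawup_time (grid ((1/2) ^ j)) (\<lambda>t. X t \<omega>) \<nu> \<partial>M)
    \<le> ennreal ((dynkin (\<nu> + 1) + 1 * (\<nu> + 1)) / a)" by simp
  then obtain j where "(\<integral>\<^sup>+\<omega>. drawup_time (grid ((1/2) ^ j)) (\<lambda>t. X t \<omega>) \<nu> \<partial>M)
    \<le> ennreal ((dynkin (\<nu> + 1) + 1 * (\<nu> + 1)) / a)"
    by (auto simp: eventually_sequentially)
  then show ?thesis by (metis ennreal_less_top order_le_less_trans)
qed

text \<open>Grid times lie above the continuous draw-up time, so the upper bounds with parameter \<open>\<epsilon>\<close> hold for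
  it, and \<open>\<epsilon>\<close> can tend to \<open>0\<close>.\<close>

theorem expected_drawup_time:
  assumes ba: "b = a" and \<nu>: "0 < \<nu>"
  shows "(\<integral>\<^sup>+\<omega>. drawup_time {0..} (\<lambda>t. X t \<omega>) \<nu> \<partial>M) = ennreal (dynkin \<nu> / a)"
    (is "?E = _")
proof (rule antisym)
  have above: "?E \<le> ennreal ((dynkin (\<nu> + \<epsilon>) + \<epsilon> * (\<nu> + \<epsilon>)) / a)" if \<epsilon>: "0 < \<epsilon>" "\<epsilon> \<le> 1" for \<epsilon>
  proof -
    have "\<forall>\<^sub>F h in at_right 0. 0 < h \<and> (\<integral>\<^sup>+\<omega>. drawup_time (grid h) (\<lambda>t. X t \<omega>) \<nu> \<partial>M)
      \<le> ennreal ((dynkin (\<nu> + \<epsilon>) + \<epsilon> * (\<nu> + \<epsilon>)) / a)"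
      by (intro eventually_conj eventually_at_right_less expected_grid_time_le \<nu> ba \<epsilon>)
    then obtain h where "0 < h" and h: "(\<integral>\<^sup>+\<omega>. drawup_time (grid h) (\<lambda>t. X t \<omega>) \<nu> \<partial>M)
      \<le> ennreal ((dynkin (\<nu> + \<epsilon>) + \<epsilon> * (\<nu> + \<epsilon>)) / a)"
      by (metis (mono_tags, lifting) eventually_happens' trivial_limit_at_right_real)
    have "?E \<le> (\<integral>\<^sup>+\<omega>. drawup_time (grid h) (\<lambda>t. X t \<omega>) \<nu> \<partial>M)"
      using \<open>0 < h\<close> by (intro nn_integral_mono drawup_time_mono grid_nonneg) auto
    then show ?thesis using h by (rule order_trans)
  qed
  have "((\<lambda>\<epsilon>. ennreal ((dynkin (\<nu> + \<epsilon>) + \<epsilon> * (\<nu> + \<epsilon>)) / a))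
      \<longlongrightarrow> ennreal ((dynkin (\<nu> + 0) + 0 * (\<nu> + 0)) / a)) (at_right 0)"
    unfolding dynkin_def by (intro tendsto_intros tendsto_ennrealI) (use variance_pos in auto)
  moreover have "\<forall>\<^sub>F \<epsilon> :: real in at_right 0. 0 < \<epsilon> \<and> \<epsilon> < 1"
    using eventually_at_right_real[of 0 "1::real"] by simp
  then have "\<forall>\<^sub>F \<epsilon> in at_right 0. ?E \<le> ennreal ((dynkin (\<nu> + \<epsilon>) + \<epsilon> * (\<nu> + \<epsilon>)) / a)"
    by eventually_elim (auto intro: above)
  ultimately have "?E \<le> ennreal ((dynkin (\<nu> + 0) + 0 * (\<nu> + 0)) / a)"
    by (rule tendsto_lowerbound) simp
  then show "?E \<le> ennreal (dynkin \<nu> / a)" by simp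
  show "ennreal (dynkin \<nu> / a) \<le> ?E"
    using expected_drawup_time_ge[OF \<nu>] grid_time_finite[OF ba] ba by simp
qed

end

section \<open>Increments of the sensor noise\<close>

text \<open>Independence between the paths of different sensors, applied to events that fix all increments of
  one path, combines with independence of the increments within each path.\<close>

lemma sensor_noise_increments_indep:
  assumes noise: "sensor_noise M N W" and r: "0 \<le> r 0" "mono r" and ne: "0 < N" "0 < K"
  shows "prob_space.indep_vars M (\<lambda>_. borel)
    (\<lambda>(n, k) \<omega>. W n (r (Suc k)) \<omega> - W n (r k) \<omega> :: real) ({1..N} \<times> {..<K})"
proof -
  interpret prob_space M using noise by (simp add: sensor_noise_def)
  let ?D = "\<lambda>(n, k) \<omega>. W n (r (Suc k)) \<omega> - W n (r k) \<omega>"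
  let ?path = "\<lambda>n \<omega>. \<lambda>t\<in>{0..}. W n t \<omega>"
  let ?P = "\<Pi>\<^sub>M t\<in>{0::real..}. (borel :: real measure)"
  have r0: "0 \<le> r k" for k using r monoD[OF r(2), of 0 k] by simp
  have W[measurable]: "W n t \<in> borel_measurable M" if "n \<in> {1..N}" "0 \<le> t" for n t
    using noise that by (auto simp: sensor_noise_def standard_brownian_motion_def)
  have time: "indep_vars (\<lambda>_. borel) (\<lambda>k. ?D (n, k)) {..<K}" if "n \<in> {1..N}" for n
    using noise that r by (auto simp: sensor_noise_def standard_brownian_motion_def)
  have sensors: "indep_vars (\<lambda>_. ?P) ?path {1..N}"
    using noise by (simp add: sensor_noise_def)
  show ?thesis
  proof (subst indep_vars_finite[where E = "\<lambda>_. sets borel"])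
    show "\<forall>A\<in>{1..N} \<times> {..<K} \<rightarrow> sets borel.
        prob (\<Inter>p\<in>{1..N} \<times> {..<K}. ?D p -` A p \<inter> space M)
        = (\<Prod>p\<in>{1..N} \<times> {..<K}. prob (?D p -` A p \<inter> space M))"
    proof
      fix A :: "nat \<times> nat \<Rightarrow> real set" assume A: "A \<in> {1..N} \<times> {..<K} \<rightarrow> sets borel"
      \<comment> \<open>All events about the increments of sensor \<open>n\<close>, collected in one event of its path.\<close>
      define B where "B n = {p \<in> space ?P. \<forall>k<K. p (r (Suc k)) - p (r k) \<in> A (n, k)}" for n
      have B: "B n \<in> sets ?P" if "n \<in> {1..N}" for n
      proof -
        have [measurable]: "(\<lambda>p. p (r k)) \<in> borel_measurable ?P" for k
          using r0 by (intro measurable_component_singleton) auto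
        have [measurable]: "A (n, k) \<in> sets borel" if "k < K" for k
          using A that \<open>n \<in> {1..N}\<close> by auto
        have "(\<Inter>k\<in>{..<K}. {p \<in> space ?P. p (r (Suc k)) - p (r k) \<in> A (n, k)}) \<in> sets ?P"
          using ne by (intro sets.finite_INT) auto
        also have "(\<Inter>k\<in>{..<K}. {p \<in> space ?P. p (r (Suc k)) - p (r k) \<in> A (n, k)}) = B n"
          using ne by (auto simp: B_def)
        finally show ?thesis .
      qed
      have path_B: "?path n -` B n \<inter> space M = (\<Inter>k\<in>{..<K}. ?D (n, k) -` A (n, k) \<inter> space M)" for n
      proof (rule set_eqI)
        fix \<omega>
        have "?path n \<omega> \<in> space ?P" by (simp add: space_PiM)
        then have "\<omega> \<in> ?path n -` B n \<inter> space M
            \<longleftrightarrow> \<omega> \<in> space M \<and> (\<forall>k<K. ?D (n, k) \<omega> \<in> A (n, k))"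
          by (simp add: B_def r0 conj_commute)
        also have "\<dots> \<longleftrightarrow> \<omega> \<in> (\<Inter>k\<in>{..<K}. ?D (n, k) -` A (n, k) \<inter> space M)"
          using ne(2) by auto
        finally show "\<omega> \<in> ?path n -` B n \<inter> space M
            \<longleftrightarrow> \<omega> \<in> (\<Inter>k\<in>{..<K}. ?D (n, k) -` A (n, k) \<inter> space M)" .
      qed
      have "(\<Inter>p\<in>{1..N} \<times> {..<K}. ?D p -` A p \<inter> space M)
          = (\<Inter>n\<in>{1..N}. ?path n -` B n \<inter> space M)"
        unfolding path_B by (rule set_eqI) (simp only: INT_iff split_paired_Ball_Sigma)
      also have "prob \<dots> = (\<Prod>n\<in>{1..N}. prob (?path n -` B n \<inter> space M))"
        using ne by (intro indep_varsD_finite[OF sensors] B) auto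
      also have "\<dots> = (\<Prod>n\<in>{1..N}. \<Prod>k<K. prob (?D (n, k) -` A (n, k) \<inter> space M))"
        unfolding path_B using ne A
        by (intro prod.cong refl indep_varsD_finite[OF time]) auto
      also have "\<dots> = (\<Prod>p\<in>{1..N} \<times> {..<K}. prob (?D p -` A p \<inter> space M))"
        by (subst prod.cartesian_product) (auto intro!: prod.cong)
      finally show "prob (\<Inter>p\<in>{1..N} \<times> {..<K}. ?D p -` A p \<inter> space M)
        = (\<Prod>p\<in>{1..N} \<times> {..<K}. prob (?D p -` A p \<inter> space M))" .
    qed
    show "?D p \<in> borel_measurable M" if "p \<in> {1..N} \<times> {..<K}" for p
      using that r0 by auto
  qed (use ne in \<open>auto simp: sets.sigma_sets_eq[of borel, simplified] Int_stable_def lessThan_empty_iff\<close>)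
qed

text \<open>Summing over the sensors groups the independent increments by time step, which preserves
  independence, and adds the variances to \<open>N \<mu>\<^sup>2 h\<close>.\<close>

lemma sensor_noise_gaussian_walk:
  fixes b \<mu> :: real
  assumes noise: "sensor_noise M N W" and N: "0 < N" and \<mu>: "\<mu> \<noteq> 0" and h: "0 < h"
  defines "X \<equiv> \<lambda>t \<omega>. b * t + \<mu> * (\<Sum>n=1..N. W n t \<omega>)"
  shows "gaussian_walk M (\<lambda>k \<omega>. X (real (Suc k) * h) \<omega> - X (real k * h) \<omega>) (real N * \<mu>\<^sup>2 / 2) b h"
proof -
  interpret prob_space M using noise by (simp add: sensor_noise_def)
  let ?r = "\<lambda>k::nat. real k * h"
  let ?D = "\<lambda>(n, k) \<omega>. W n (?r (Suc k)) \<omega> - W n (?r k) \<omega>"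
  let ?\<xi> = "\<lambda>k \<omega>. X (?r (Suc k)) \<omega> - X (?r k) \<omega>"
  have \<xi>: "?\<xi> k = (\<lambda>\<omega>. b * h + \<mu> * (\<Sum>n=1..N. ?D (n, k) \<omega>))" for k
    by (simp add: X_def fun_eq_iff algebra_simps sum_subtractf)
  have all: "indep_vars (\<lambda>_. borel) ?D ({1..N} \<times> {..<Suc K})" for K
    using sensor_noise_increments_indep[OF noise, of ?r "Suc K"] N h
    by (simp add: mono_def)
  show ?thesis
  proof
    fix K
    have "indep_vars (\<lambda>k. PiM ({1..N} \<times> {k}) (\<lambda>_. borel))
        (\<lambda>k \<omega>. restrict (\<lambda>i. ?D i \<omega>) ({1..N} \<times> {k})) {..<Suc K}"
      by (rule indep_vars_restrict[OF all]) (auto simp: disjoint_family_on_def)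
    then have "indep_vars (\<lambda>_. borel)
        (\<lambda>k \<omega>. b * h + \<mu> * (\<Sum>n=1..N. restrict (\<lambda>i. ?D i \<omega>) ({1..N} \<times> {k}) (n, k))) {..<Suc K}"
      by (rule indep_vars_compose2)
        (intro borel_measurable_add borel_measurable_times borel_measurable_sum
          measurable_component_singleton; auto)
    then have "indep_vars (\<lambda>_. borel) ?\<xi> {..<Suc K}"
      unfolding \<xi> by simp
    then show "indep_vars (\<lambda>_. borel) ?\<xi> {..<K}"
      by (rule indep_vars_subset) auto
  next
    fix k
    have "indep_vars (\<lambda>_. borel) (\<lambda>n. ?D (n, k)) {1..N}"
    proof -
      have "indep_vars (\<lambda>_. \<Pi>\<^sub>M t\<in>{0::real..}. (borel :: real measure)) (\<lambda>n \<omega>. \<lambda>t\<in>{0..}. W n t \<omega>) {1..N}"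
        using noise by (simp add: sensor_noise_def)
      then have "indep_vars (\<lambda>_. borel)
          (\<lambda>n \<omega>. (\<lambda>t\<in>{0..}. W n t \<omega>) (?r (Suc k)) - (\<lambda>t\<in>{0..}. W n t \<omega>) (?r k)) {1..N}"
      proof (rule indep_vars_compose2[where Y = "\<lambda>_ p. p (?r (Suc k)) - p (?r k)"])
        show "(\<lambda>p. p (?r (Suc k)) - p (?r k)) \<in> borel_measurable (\<Pi>\<^sub>M t\<in>{0::real..}. (borel :: real measure))"
          using h by (intro borel_measurable_diff measurable_component_singleton) auto
      qed
      then show ?thesis using h by simp
    qed
    moreover have "distributed M lborel (?D (n, k)) (normal_density 0 (sqrt h))" if "n \<in> {1..N}" for n
    proof -
      have "distributed M lborel (\<lambda>\<omega>. W n (?r (Suc k)) \<omega> - W n (?r k) \<omega>)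
          (normal_density 0 (sqrt (?r (Suc k) - ?r k)))"
        using noise that h unfolding sensor_noise_def standard_brownian_motion_def by auto
      then show ?thesis by (simp add: algebra_simps)
    qed
    ultimately have "distributed M lborel (\<lambda>\<omega>. \<Sum>n=1..N. ?D (n, k) \<omega>)
        (normal_density (\<Sum>n=1..N. 0) (sqrt (\<Sum>n=1..N. (sqrt h)\<^sup>2)))"
      using N h by (intro sum_indep_normal) auto
    then have "distributed M lborel (\<lambda>\<omega>. \<Sum>n=1..N. ?D (n, k) \<omega>) (normal_density 0 (sqrt (real N * h)))"
      using h by simp
    then have "distributed M lborel (?\<xi> k)
        (normal_density (b * h + \<mu> * 0) (\<bar>\<mu>\<bar> * sqrt (real N * h)))"
      unfolding \<xi> by (rule normal_density_affine) (use N h \<mu> in auto)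
    moreover have "\<bar>\<mu>\<bar> * sqrt (real N * h) = sqrt (2 * (real N * \<mu>\<^sup>2 / 2) * h)"
      by (simp add: real_sqrt_mult)
    ultimately show "distributed M lborel (?\<xi> k) (normal_density (b * h) (sqrt (2 * (real N * \<mu>\<^sup>2 / 2) * h)))"
      by simp
  qed (use N \<mu> h in auto)
qed

lemma sensor_noise_drifted_brownian:
  assumes noise: "sensor_noise M N W" and N: "0 < N" and \<mu>: "\<mu> \<noteq> 0"
  shows "drifted_brownian M (\<lambda>t \<omega>. b * t + \<mu> * (\<Sum>n=1..N. W n t \<omega>)) (real N * \<mu>\<^sup>2 / 2) b"
proof -
  interpret prob_space M using noise by (simp add: sensor_noise_def)
  have W: "standard_brownian_motion M (W n)" if "n \<in> {1..N}" for n
    using noise that by (simp add: sensor_noise_def)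
  show ?thesis
  proof (intro drifted_brownian.intro drifted_brownian_axioms.intro prob_space_axioms)
    fix t :: real assume "0 \<le> t"
    then have "W n t \<in> borel_measurable M" if "n \<in> {1..N}" for n
      using W[OF that] by (simp add: standard_brownian_motion_def)
    then show "(\<lambda>\<omega>. b * t + \<mu> * (\<Sum>n=1..N. W n t \<omega>)) \<in> borel_measurable M"
      by (intro borel_measurable_add borel_measurable_times borel_measurable_sum) auto
  next
    fix \<omega> assume "\<omega> \<in> space M"
    then show "continuous_on {0..} (\<lambda>t. b * t + \<mu> * (\<Sum>n=1..N. W n t \<omega>))"
      using W by (intro continuous_intros) (simp add: standard_brownian_motion_def)
  qed (rule sensor_noise_gaussian_walk[OF assms])
qed

section \<open>CUSUM under the attack\<close>

text \<open>The CUSUM process \<open>u\<close> under the attack: the reported drift \<open>N \<mu>\<close> of sensor 1 adds \<open>N \<mu>\<^sup>2 t\<close>, which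
  turns the downward drift \<open>- N \<mu>\<^sup>2 / 2\<close> into \<open>N \<mu>\<^sup>2 / 2\<close>, and the honest sensors add \<open>\<mu>\<^sup>2\<close> each
  from the change on.\<close>

definition attacked_statistic ::
  "nat \<Rightarrow> (nat \<Rightarrow> real \<Rightarrow> 'a \<Rightarrow> real) \<Rightarrow> real \<Rightarrow> ennreal \<Rightarrow> real \<Rightarrow> 'a \<Rightarrow> real" where
  "attacked_statistic N W \<mu> \<tau> t \<omega> = real N * \<mu>\<^sup>2 / 2 * t
     + (real N - 1) * \<mu>\<^sup>2 * enn2real (ennreal t - \<tau>) + \<mu> * (\<Sum>n=1..N. W n t \<omega>)"

lemma cusum_u_attack:
  assumes "0 < N" "0 \<le> t"
  shows "cusum_u N \<mu> (\<lambda>n\<in>{1..N}. \<lambda>t\<in>{0..}. report W \<mu> \<tau> 1 (attack N W \<mu>) n t \<omega>) t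
    = attacked_statistic N W \<mu> \<tau> t \<omega>"
proof -
  let ?d = "enn2real (ennreal t - \<tau>)"
  let ?R = "\<lambda>n. report W \<mu> \<tau> 1 (attack N W \<mu>) n t \<omega>"
  have split: "{1..N} = insert 1 {2..N}" using assms(1) by auto
  have "(\<Sum>n=1..N. \<mu> * ?R n) = (\<Sum>n=1..N. \<mu> * W n t \<omega> + (if n = 1 then real N * \<mu>\<^sup>2 * t else \<mu>\<^sup>2 * ?d))"
    by (intro sum.cong refl)
       (simp add: report_def attack_def observation_def algebra_simps power2_eq_square)
  also have "\<dots> = (\<Sum>n=1..N. \<mu> * W n t \<omega>) + (real N * \<mu>\<^sup>2 * t + (real N - 1) * (\<mu>\<^sup>2 * ?d))"
    unfolding sum.distrib split using assms(1) by simp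
  finally show ?thesis
    using assms(2)
    by (simp add: cusum_u_def attacked_statistic_def sum_distrib_left algebra_simps)
qed

lemma elapsed_time:
  assumes "0 \<le> t"
  shows "enn2real (ennreal t - \<tau>) = (if \<tau> = \<top> then 0 else max 0 (t - enn2real \<tau>))"
proof (cases \<tau>)
  case (real c)
  then show ?thesis using assms by (simp add: ennreal_minus max_def ennreal_neg)
qed (simp add: ennreal_minus_eq_0)

lemma measurable_attacked_statistic:
  assumes "sensor_noise M N W" "0 \<le> t"
  shows "attacked_statistic N W \<mu> \<tau> t \<in> borel_measurable M"
proof -
  have "W n t \<in> borel_measurable M" if "n \<in> {1..N}" for n
    using assms that by (auto simp: sensor_noise_def standard_brownian_motion_def)
  then show ?thesis
    unfolding attacked_statistic_def[abs_def]
    by (intro borel_measurable_add borel_measurable_times borel_measurable_sum) auto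
qed

lemma continuous_attacked_statistic:
  assumes "sensor_noise M N W" "\<omega> \<in> space M"
  shows "continuous_on {0..} (\<lambda>t. attacked_statistic N W \<mu> \<tau> t \<omega>)"
proof -
  have W: "continuous_on {0..} (\<lambda>t. W n t \<omega>)" if "n \<in> {1..N}" for n
    using assms that by (auto simp: sensor_noise_def standard_brownian_motion_def)
  have "continuous_on {0..} (\<lambda>t. if \<tau> = \<top> then 0 else max 0 (t - enn2real \<tau>))"
    by (cases "\<tau> = \<top>") (simp, simp only: if_False, intro continuous_intros)
  then have "continuous_on {0..} (\<lambda>t. enn2real (ennreal t - \<tau>))"
    by (rule continuous_on_cong[THEN iffD1, OF refl, rotated]) (simp add: elapsed_time)
  then show ?thesis
    unfolding attacked_statistic_def by (intro continuous_intros W)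
qed

lemma alarm_attack:
  assumes noise: "sensor_noise M N W" and N: "0 < N" and \<omega>: "\<omega> \<in> space M"
  shows "alarm N W \<mu> (cusum N \<mu> \<nu>) \<tau> 1 (attack N W \<mu>) \<omega>
    = drawup_time {0..} (\<lambda>t. attacked_statistic N W \<mu> \<tau> t \<omega>) \<nu>"
proof -
  let ?u = "cusum_u N \<mu> (\<lambda>n\<in>{1..N}. \<lambda>t\<in>{0..}. report W \<mu> \<tau> 1 (attack N W \<mu>) n t \<omega>)"
  have u: "?u t = attacked_statistic N W \<mu> \<tau> t \<omega>" if "t \<in> {0..}" for t
    using cusum_u_attack[OF N] that by simp
  have "continuous_on {0..} ?u"
    using continuous_attacked_statistic[OF noise \<omega>, of \<mu> \<tau>]
    by (rule continuous_on_cong[THEN iffD2, OF refl, rotated]) (rule u)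
  then have "alarm N W \<mu> (cusum N \<mu> \<nu>) \<tau> 1 (attack N W \<mu>) \<omega> = drawup_time {0..} ?u \<nu>"
    unfolding alarm_def by (rule cusum_eq_drawup_time)
  also have "\<dots> = drawup_time {0..} (\<lambda>t. attacked_statistic N W \<mu> \<tau> t \<omega>) \<nu>"
    by (rule drawup_time_cong) (rule u)
  finally show ?thesis .
qed

lemma measurable_alarm_attack:
  assumes "sensor_noise M N W" "0 < N"
  shows "alarm N W \<mu> (cusum N \<mu> \<nu>) \<tau> 1 (attack N W \<mu>) \<in> borel_measurable M"
proof -
  have "(\<lambda>\<omega>. drawup_time {0..} (\<lambda>t. attacked_statistic N W \<mu> \<tau> t \<omega>) \<nu>) \<in> borel_measurable M"
    by (intro measurable_drawup_time measurable_attacked_statistic[OF assms(1)]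
        continuous_attacked_statistic[OF assms(1)])
  then show ?thesis
    by (rule measurable_cong[THEN iffD2, rotated]) (rule alarm_attack[OF assms])
qed

lemma measurable_report_attack:
  assumes "sensor_noise M N W" "n \<in> {1..N}" "0 \<le> t"
  shows "report W \<mu> \<tau> 1 (attack N W \<mu>) n t \<in> borel_measurable M"
proof -
  have "1 \<in> {1..N}" using assms(2) by auto
  then have "W n t \<in> borel_measurable M" "W 1 t \<in> borel_measurable M"
    using assms by (auto simp: sensor_noise_def standard_brownian_motion_def)
  then show ?thesis
    unfolding report_def[abs_def] attack_def observation_def by (cases "n = 1") simp_all
qed

lemma attack_in_strategies:
  assumes "sensor_noise M N W" "0 < N"
  shows "attack N W \<mu> \<in> strategies M N W \<mu> (cusum N \<mu> \<nu>) 1"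
  using measurable_report_attack[OF assms(1)] measurable_alarm_attack[OF assms] assms(2)
  by (simp add: strategies_def)

text \<open>Conditional expectation preserves the mean, and a mean never exceeds the essential supremum.\<close>

lemma nn_integral_le_esssup_nn_cond_exp:
  assumes "prob_space M" and sub: "subalgebra M F" and f: "f \<in> borel_measurable M"
  shows "(\<integral>\<^sup>+\<omega>. f \<omega> \<partial>M) \<le> esssup M (nn_cond_exp M F f)"
proof -
  interpret prob_space M by fact
  interpret finite_measure_subalgebra M F by unfold_locales (rule sub)
  have "(\<integral>\<^sup>+\<omega>. f \<omega> \<partial>M) = (\<integral>\<^sup>+\<omega>. nn_cond_exp M F f \<omega> \<partial>M)"
    using nn_cond_exp_intg[of "\<lambda>_. 1" f] f by simp
  also have "\<dots> \<le> (\<integral>\<^sup>+\<omega>. esssup M (nn_cond_exp M F f) \<partial>M)"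
    by (intro nn_integral_mono_AE esssup_AE)
  also have "\<dots> = esssup M (nn_cond_exp M F f)" by (simp add: emeasure_space_1)
  finally show ?thesis .
qed

text \<open>The change time \<open>0\<close> together with the attack is one of the scenarios in the worst case.\<close>

lemma detection_delay_ge:
  assumes noise: "sensor_noise M N W" and N: "0 < N"
  shows "expected_alarm M N W \<mu> (cusum N \<mu> \<nu>) 0 1 (attack N W \<mu>)
    \<le> detection_delay M N W \<mu> (cusum N \<mu> \<nu>)"
proof -
  let ?F = "fusion_info M N W \<mu> 0 1 (attack N W \<mu>) 0"
  let ?T = "alarm N W \<mu> (cusum N \<mu> \<nu>) 0 1 (attack N W \<mu>)"
  have "subalgebra M ?F"
  proof -
    let ?G = "{report W \<mu> 0 1 (attack N W \<mu>) n r -` A \<inter> space M | n r A.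
       n \<in> {1..N} \<and> 0 \<le> r \<and> ennreal r \<le> 0 \<and> A \<in> sets borel}"
    have "?G \<subseteq> sets M"
      using measurable_sets[OF measurable_report_attack[OF noise]] by blast
    then have "sets (sigma (space M) ?G) \<subseteq> sets M"
      using sets.space_closed[of M] by (subst sigma_le_sets) auto
    then show ?thesis unfolding subalgebra_def fusion_info_def by (simp add: space_measure_of_conv)
  qed
  then have "(\<integral>\<^sup>+\<omega>. ?T \<omega> \<partial>M) \<le> esssup M (nn_cond_exp M ?F ?T)"
    using noise measurable_alarm_attack[OF noise N]
    by (intro nn_integral_le_esssup_nn_cond_exp) (auto simp: sensor_noise_def)
  also have "\<dots> = esssup M (nn_cond_exp M ?F (\<lambda>\<omega>. ?T \<omega> - 0))" by simp
  also have "\<dots> \<le> detection_delay M N W \<mu> (cusum N \<mu> \<nu>)"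
    unfolding detection_delay_def
    using N by (intro SUP_upper2[of 0] SUP_upper2[of 1]
        SUP_upper2[OF attack_in_strategies[OF noise N]]) auto
  finally show ?thesis by (simp add: expected_alarm_def)
qed

lemma ARL_le:
  assumes "sensor_noise M N W" "0 < N"
  shows "ARL M N W \<mu> (cusum N \<mu> \<nu>) \<le> expected_alarm M N W \<mu> (cusum N \<mu> \<nu>) \<top> 1 (attack N W \<mu>)"
  unfolding ARL_def
  using assms by (intro INF_lower2[of 1] INF_lower attack_in_strategies) auto

lemma expected_alarm_attack:
  assumes "sensor_noise M N W" "0 < N"
  shows "expected_alarm M N W \<mu> (cusum N \<mu> \<nu>) \<tau> 1 (attack N W \<mu>)
    = (\<integral>\<^sup>+\<omega>. drawup_time {0..} (\<lambda>t. attacked_statistic N W \<mu> \<tau> t \<omega>) \<nu> \<partial>M)"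
  unfolding expected_alarm_def by (intro nn_integral_cong alarm_attack[OF assms])

lemma attacked_statistic_no_change:
  "attacked_statistic N W \<mu> \<top> t \<omega> = real N * \<mu>\<^sup>2 / 2 * t + \<mu> * (\<Sum>n=1..N. W n t \<omega>)"
  by (simp add: attacked_statistic_def)

lemma attacked_statistic_immediate_change:
  assumes "0 \<le> t"
  shows "attacked_statistic N W \<mu> 0 t \<omega>
    = (3 * real N / 2 - 1) * \<mu>\<^sup>2 * t + \<mu> * (\<Sum>n=1..N. W n t \<omega>)"
  using assms by (simp add: attacked_statistic_def algebra_simps)

text \<open>The change only adds drift, hence raises every increment of the statistic.\<close>

lemma immediate_change_alarms_earlier:
  assumes N: "0 < N" and G: "G \<subseteq> {0..}"
  shows "drawup_time G (\<lambda>t. attacked_statistic N W \<mu> 0 t \<omega>) \<nu>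
    \<le> drawup_time G (\<lambda>t. attacked_statistic N W \<mu> \<top> t \<omega>) \<nu>"
proof (rule drawup_time_mono[OF subset_refl])
  fix s t assume st: "s \<in> G" "t \<in> G" "s \<le> t"
    and up: "\<nu> \<le> attacked_statistic N W \<mu> \<top> t \<omega> - attacked_statistic N W \<mu> \<top> s \<omega>"
  let ?c = "(real N - 1) * \<mu>\<^sup>2"
  have drift: "attacked_statistic N W \<mu> 0 r \<omega> = attacked_statistic N W \<mu> \<top> r \<omega> + ?c * r"
    if "r \<in> G" for r
    using that G by (auto simp: attacked_statistic_def)
  have "0 \<le> ?c * (t - s)" using N st by simp
  then show "\<nu> \<le> attacked_statistic N W \<mu> 0 t \<omega> - attacked_statistic N W \<mu> 0 s \<omega>"
    using up unfolding drift[OF st(1)] drift[OF st(2)] by (simp only: right_diff_distrib)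
qed

lemma expected_alarm_no_change:
  assumes noise: "sensor_noise M N W" and N: "0 < N" and \<mu>: "\<mu> \<noteq> 0" and \<nu>: "0 < \<nu>"
  shows "expected_alarm M N W \<mu> (cusum N \<mu> \<nu>) \<top> 1 (attack N W \<mu>)
    = ennreal ((exp (- \<nu>) + \<nu> - 1) / (real N * \<mu>\<^sup>2 / 2))"
proof -
  interpret drifted_brownian M "\<lambda>t \<omega>. real N * \<mu>\<^sup>2 / 2 * t + \<mu> * (\<Sum>n=1..N. W n t \<omega>)"
    "real N * \<mu>\<^sup>2 / 2" "real N * \<mu>\<^sup>2 / 2"
    by (rule sensor_noise_drifted_brownian[OF noise N \<mu>])
  show ?thesis
    unfolding expected_alarm_attack[OF noise N] attacked_statistic_no_change
    using expected_drawup_time[OF refl \<nu>] by (simp add: dynkin_def)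
qed

text \<open>Without a change the drift is \<open>a = N \<mu>\<^sup>2 / 2\<close>, with a change at time \<open>0\<close> it is
  \<open>b = (3 N / 2 - 1) \<mu>\<^sup>2 \<ge> a\<close>; finiteness of the grid times carries over from the former.\<close>

lemma expected_alarm_immediate_change:
  assumes noise: "sensor_noise M N W" and N: "0 < N" and \<mu>: "\<mu> \<noteq> 0" and \<nu>: "0 < \<nu>"
  shows "ennreal ((exp (- \<nu>) + \<nu> - 1) / ((3 * real N / 2 - 1) * \<mu>\<^sup>2))
    \<le> expected_alarm M N W \<mu> (cusum N \<mu> \<nu>) 0 1 (attack N W \<mu>)"
proof -
  let ?a = "real N * \<mu>\<^sup>2 / 2" and ?b = "(3 * real N / 2 - 1) * \<mu>\<^sup>2"
  let ?X = "\<lambda>b t \<omega>. b * t + \<mu> * (\<Sum>n=1..N. W n t \<omega>)"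
  interpret no_change: drifted_brownian M "?X ?a" ?a ?a
    by (rule sensor_noise_drifted_brownian[OF noise N \<mu>])
  interpret change: drifted_brownian M "?X ?b" ?a ?b
    by (rule sensor_noise_drifted_brownian[OF noise N \<mu>])
  have change_eq: "drawup_time G (\<lambda>t. ?X ?b t \<omega>) \<nu>
      = drawup_time G (\<lambda>t. attacked_statistic N W \<mu> 0 t \<omega>) \<nu>" if "G \<subseteq> {0..}" for G \<omega> \<nu>
    using that by (intro drawup_time_cong) (auto simp: attacked_statistic_immediate_change)
  have "ennreal (dynkin \<nu> / ?b) \<le> (\<integral>\<^sup>+\<omega>. drawup_time {0..} (\<lambda>t. ?X ?b t \<omega>) \<nu> \<partial>M)"
  proof (rule change.expected_drawup_time_ge[OF \<nu>])
    have "real N / 2 \<le> 3 * real N / 2 - 1" using N by simp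
    then have "real N / 2 * \<mu>\<^sup>2 \<le> ?b" by (intro mult_right_mono) auto
    then show "?a \<le> ?b" by simp
    fix \<nu> :: real assume "0 < \<nu>"
    then obtain j where
      "(\<integral>\<^sup>+\<omega>. drawup_time (grid ((1/2) ^ j)) (\<lambda>t. ?X ?a t \<omega>) \<nu> \<partial>M) < \<top>"
      using no_change.grid_time_finite by blast
    moreover have "(\<integral>\<^sup>+\<omega>. drawup_time (grid ((1/2) ^ j)) (\<lambda>t. ?X ?b t \<omega>) \<nu> \<partial>M)
      \<le> (\<integral>\<^sup>+\<omega>. drawup_time (grid ((1/2) ^ j)) (\<lambda>t. ?X ?a t \<omega>) \<nu> \<partial>M)"
    proof -
      have grid: "grid ((1/2) ^ j) \<subseteq> {0..}" by (rule grid_nonneg) simp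
      show ?thesis
        unfolding attacked_statistic_no_change[symmetric] change_eq[OF grid]
        by (intro nn_integral_mono immediate_change_alarms_earlier[OF N grid])
    qed
    ultimately show "\<exists>j. (\<integral>\<^sup>+\<omega>. drawup_time (grid ((1/2) ^ j)) (\<lambda>t. ?X ?b t \<omega>) \<nu> \<partial>M) < \<top>"
      using order_le_less_trans by blast
  qed
  then show ?thesis
    unfolding expected_alarm_attack[OF noise N] change_eq[OF subset_refl] dynkin_def .
qed

theorem proposition3p1:
  fixes M :: "'a measure" and N :: nat and W :: "nat \<Rightarrow> real \<Rightarrow> 'a \<Rightarrow> real" and \<mu> :: real
  assumes "N \<ge> 3" and "\<mu> \<noteq> 0" and "sensor_noise M N W"
  shows "(\<forall>\<nu>>0.
            ARL M N W \<mu> (cusum N \<mu> \<nu>)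
              \<le> expected_alarm M N W \<mu> (cusum N \<mu> \<nu>) \<top> 1 (attack N W \<mu>) \<and>
            expected_alarm M N W \<mu> (cusum N \<mu> \<nu>) \<top> 1 (attack N W \<mu>)
              = ennreal ((exp (- \<nu>) + \<nu> - 1) / (real N * \<mu>\<^sup>2 / 2)) \<and>
            detection_delay M N W \<mu> (cusum N \<mu> \<nu>)
              \<ge> expected_alarm M N W \<mu> (cusum N \<mu> \<nu>) 0 1 (attack N W \<mu>) \<and>
            expected_alarm M N W \<mu> (cusum N \<mu> \<nu>) 0 1 (attack N W \<mu>)
              \<ge> ennreal ((exp (- \<nu>) + \<nu> - 1) / ((3 * real N / 2 - 1) * \<mu>\<^sup>2))) \<and>
         ((\<lambda>\<nu>. expected_alarm M N W \<mu> (cusum N \<mu> \<nu>) \<top> 1 (attack N W \<mu>)) \<longlongrightarrow> \<top>) at_top \<and>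
         (\<exists>c>0. \<exists>C>0. \<forall>\<nu>>0.
            ennreal c * expected_alarm M N W \<mu> (cusum N \<mu> \<nu>) \<top> 1 (attack N W \<mu>)
              \<le> expected_alarm M N W \<mu> (cusum N \<mu> \<nu>) 0 1 (attack N W \<mu>) \<and>
            expected_alarm M N W \<mu> (cusum N \<mu> \<nu>) 0 1 (attack N W \<mu>)
              \<le> ennreal C * expected_alarm M N W \<mu> (cusum N \<mu> \<nu>) \<top> 1 (attack N W \<mu>) \<and>
            ennreal c * ARL M N W \<mu> (cusum N \<mu> \<nu>)
              \<le> detection_delay M N W \<mu> (cusum N \<mu> \<nu>))"
proof -
  let ?a = "real N * \<mu>\<^sup>2 / 2" and ?b = "(3 * real N / 2 - 1) * \<mu>\<^sup>2"
  let ?E = "\<lambda>\<tau> \<nu>. expected_alarm M N W \<mu> (cusum N \<mu> \<nu>) \<tau> 1 (attack N W \<mu>)"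
  have N: "0 < N" using assms(1) by simp
  note noise = assms(3)
  note arl = ARL_le[OF noise N] and delay = detection_delay_ge[OF noise N]
  note E_top = expected_alarm_no_change[OF noise N assms(2)]
    and E_0 = expected_alarm_immediate_change[OF noise N assms(2)]
  have a: "0 < ?a" using N assms(2) by simp
  have b: "0 < ?b" using assms(1,2) by (intro mult_pos_pos) auto
  have unbounded: "(?E \<top> \<longlongrightarrow> \<top>) at_top"
  proof -
    have "\<forall>\<^sub>F \<nu> in at_top. Z \<le> (exp (- \<nu>) + \<nu> - 1) / ?a" for Z
      using eventually_ge_at_top[of "Z * ?a + 1"]
    proof eventually_elim
      case (elim \<nu>)
      then have "Z * ?a \<le> exp (- \<nu>) + \<nu> - 1" using exp_gt_zero[of "- \<nu>"] by linarith
      then show ?case using a by (simp only: pos_le_divide_eq)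
    qed
    then have "filterlim (\<lambda>\<nu>. (exp (- \<nu>) + \<nu> - 1) / ?a) at_top at_top"
      unfolding filterlim_at_top by blast
    then have "((\<lambda>\<nu>. ennreal ((exp (- \<nu>) + \<nu> - 1) / ?a)) \<longlongrightarrow> \<top>) at_top"
      by (simp add: ennreal_tendsto_top_eq_at_top)
    then show ?thesis
      by (rule tendsto_cong[THEN iffD1, rotated])
        (use eventually_gt_at_top[of 0] in eventually_elim, simp only: E_top)
  qed
  have ratio: "0 < ?a / ?b" using a b by (rule divide_pos_pos)
  have lower: "ennreal (?a / ?b) * ?E \<top> \<nu> \<le> ?E 0 \<nu>" if \<nu>: "0 < \<nu>" for \<nu>
  proof -
    have cancel: "c / d * (x / c) = x / d" if "0 < c" for c d x :: real
      using that by simp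
    have "ennreal (?a / ?b) * ?E \<top> \<nu> = ennreal (?a / ?b * ((exp (- \<nu>) + \<nu> - 1) / ?a))"
      unfolding E_top[OF \<nu>] by (intro ennreal_mult'[symmetric] less_imp_le[OF ratio])
    also have "?a / ?b * ((exp (- \<nu>) + \<nu> - 1) / ?a) = (exp (- \<nu>) + \<nu> - 1) / ?b"
      using cancel a by blast
    also have "ennreal \<dots> \<le> ?E 0 \<nu>" by (rule E_0[OF \<nu>])
    finally show ?thesis .
  qed
  have upper: "?E 0 \<nu> \<le> ennreal 1 * ?E \<top> \<nu>" for \<nu>
    unfolding expected_alarm_attack[OF noise N] ennreal_1 mult_1
    by (intro nn_integral_mono immediate_change_alarms_earlier N) simp
  have delay_arl: "ennreal (?a / ?b) * ARL M N W \<mu> (cusum N \<mu> \<nu>)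
      \<le> detection_delay M N W \<mu> (cusum N \<mu> \<nu>)" if "0 < \<nu>" for \<nu>
    using mult_left_mono[OF arl] lower[OF that] delay by (meson order_trans zero_le)
  show ?thesis
  proof (intro conjI)
    show "\<exists>c>0. \<exists>C>0. \<forall>\<nu>>0. ennreal c * ?E \<top> \<nu> \<le> ?E 0 \<nu> \<and> ?E 0 \<nu> \<le> ennreal C * ?E \<top> \<nu> \<and>
        ennreal c * ARL M N W \<mu> (cusum N \<mu> \<nu>) \<le> detection_delay M N W \<mu> (cusum N \<mu> \<nu>)"
      using ratio lower upper delay_arl zero_less_one by blast
  qed (use arl delay E_top E_0 unbounded in blast)+
qed

end
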